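(* Fix an integer $k\ge 3$ and let $\mathcal{B}_n=\mathcal{B}_n^{(k)}$ be the class of all bipartite $k$-graphs with vertex set $[n]$. All but $|\mathcal{B}_n|/2^{\Omega(n^{k-1})}$ many $H\in\mathcal{B}_n$ admit a unique bipartition $[n]=X_H\,\dot\cup\,Y_H$, and this bipartition is constructible in maximum time $O(n^k)$. That is, there exist constants $c,C>0$ and $n_0$ depending only on $k$ and a deterministic algorithm such that for every $n\ge n_0$ there is a subclass $\mathcal{G}_n\subseteq\mathcal{B}_n$ with $|\mathcal{B}_n\setminus\mathcal{G}_n|\le|\mathcal{B}_n|/2^{cn^{k-1}}$ such that every $H\in\mathcal{G}_n$ has exactly one bipartition (up to interchanging the two classes), and the algorithm, on input $H\in\mathcal{G}_n$, constructs it in time at most $Cn^k$.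
   Context: A $k$-uniform hypergraph ($k$-graph) $H$ is a pair $(V_H,E_H)$ with $E_H\subseteq\binom{V_H}{k}$. $H$ is bipartite if there is a partition $V_H=X_H\,\dot\cup\,Y_H$, called a bipartition of $H$, such that both $X_H$ and $Y_H$ meet every edge of $H$. $\mathcal{B}_n=\mathcal{B}_n^{(k)}$ is the class of all bipartite $k$-graphs with the fixed labelled vertex set $[n]=\{1,\dots,n\}$. The input consists of $H$ only; no bipartition is given. Running time is the number of elementary operations, where a query of whether a given $k$-set is an edge of $H$ counts as one operation. *)

theory Defs
  imports Complex_Main "HOL-Library.Ramsey"
begin

type_synonym 'a hypergraph = "'a set \<times> 'a set set"

abbreviation verts :: "'a hypergraph \<Rightarrow> 'a set" where
  "verts H \<equiv> fst H"

abbreviation edges :: "'a hypergraph \<Rightarrow> 'a set set" where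
  "edges H \<equiv> snd H"

definition uniform_hypergraph :: "nat \<Rightarrow> 'a hypergraph \<Rightarrow> bool" where
  "uniform_hypergraph k H \<longleftrightarrow> edges H \<subseteq> nsets (verts H) k"

definition bipartition :: "'a hypergraph \<Rightarrow> 'a set \<Rightarrow> 'a set \<Rightarrow> bool" where
  "bipartition H X Y \<longleftrightarrow>
     X \<union> Y = verts H \<and> X \<inter> Y = {} \<and>
     (\<forall>e\<in>edges H. e \<inter> X \<noteq> {} \<and> e \<inter> Y \<noteq> {})"

definition bipartite :: "'a hypergraph \<Rightarrow> bool" where
  "bipartite H \<longleftrightarrow> (\<exists>X Y. bipartition H X Y)"

definition unique_bipartition :: "'a hypergraph \<Rightarrow> bool" where
  "unique_bipartition H \<longleftrightarrow>
     (\<exists>X Y. bipartition H X Y \<and>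
        (\<forall>X' Y'. bipartition H X' Y' \<longrightarrow> (X' = X \<and> Y' = Y) \<or> (X' = Y \<and> Y' = X)))"

definition bipartite_graphs :: "nat \<Rightarrow> nat \<Rightarrow> nat hypergraph set" where
  "bipartite_graphs k n = {H. verts H = {1..n} \<and> uniform_hypergraph k H \<and> bipartite H}"

lemma finite_bipartite_graphs: "finite (bipartite_graphs k n)"
proof (rule finite_subset)
  show "bipartite_graphs k n \<subseteq> {{1..n}} \<times> Pow (Pow {1..n})"
    unfolding bipartite_graphs_def uniform_hypergraph_def nsets_def
    by (clarsimp simp del: atLeastAtMost_iff) blast
qed simp

text \<open>
  Programs are deterministic while-programs over finitely many registers and
  arrays of natural numbers (registers and arrays are named by numbers).
  Every basic instruction and every evaluation of a test is one elementary
  operation. \<open>Query\<close> is the only access to the edges of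
  the input hypergraph; since all its edges have \<open>k\<close> elements, querying a set
  of another size answers 0.
\<close>

datatype prog =
    Const nat nat              (* r x := c *)
  | Copy nat nat               (* r x := r y *)
  | Add nat nat nat            (* r x := r y + r z *)
  | Sub nat nat nat            (* r x := r y - r z, truncated at 0 *)
  | Load nat nat nat           (* r x := a[r i], arguments x a i *)
  | Store nat nat nat          (* a[r i] := r x, arguments a i x *)
  | Query nat "nat list"       (* r x := 1 if {r y | y in ys} is an edge, else 0 *)
  | Seq prog prog
  | IfLess nat nat prog prog   (* test: r x < r y *)
  | WhileLess nat nat prog     (* test: r x < r y *)

record state =
  reg :: "nat \<Rightarrow> nat"
  arr :: "nat \<Rightarrow> nat \<Rightarrow> nat"

abbreviation set_reg :: "nat \<Rightarrow> nat \<Rightarrow> state \<Rightarrow> state" where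
  "set_reg x v s \<equiv> s\<lparr>reg := (reg s)(x := v)\<rparr>"

text \<open>
  \<open>exec W E p s t s'\<close>: on the edge set \<open>E\<close>, the program \<open>p\<close> started in \<open>s\<close>
  halts in \<open>s'\<close> after exactly \<open>t\<close> elementary operations. Memory cells hold
  words of value at most \<open>W\<close>: an instruction whose result would exceed \<open>W\<close>
  has no successor state. This rules out packing many values into one cell,
  which would make unit-cost addition unrealistic.
\<close>

inductive exec :: "nat \<Rightarrow> nat set set \<Rightarrow> prog \<Rightarrow> state \<Rightarrow> nat \<Rightarrow> state \<Rightarrow> bool"
  for W :: nat and E :: "nat set set" where
  Const: "c \<le> W \<Longrightarrow> exec W E (Const x c) s 1 (set_reg x c s)"
| Copy: "exec W E (Copy x y) s 1 (set_reg x (reg s y) s)"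
| Add: "reg s y + reg s z \<le> W \<Longrightarrow>
    exec W E (Add x y z) s 1 (set_reg x (reg s y + reg s z) s)"
| Sub: "exec W E (Sub x y z) s 1 (set_reg x (reg s y - reg s z) s)"
| Load: "exec W E (Load x a i) s 1 (set_reg x (arr s a (reg s i)) s)"
| Store: "exec W E (Store a i x) s 1
    (s\<lparr>arr := (arr s)(a := (arr s a)(reg s i := reg s x))\<rparr>)"
| Query: "exec W E (Query x ys) s 1
    (set_reg x (if reg s ` set ys \<in> E then 1 else 0) s)"
| Seq: "exec W E p s t s' \<Longrightarrow> exec W E q s' t' s'' \<Longrightarrow>
    exec W E (Seq p q) s (t + t') s''"
| IfTrue: "reg s x < reg s y \<Longrightarrow> exec W E p s t s' \<Longrightarrow>
    exec W E (IfLess x y p q) s (Suc t) s'"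
| IfFalse: "\<not> reg s x < reg s y \<Longrightarrow> exec W E q s t s' \<Longrightarrow>
    exec W E (IfLess x y p q) s (Suc t) s'"
| WhileTrue: "reg s x < reg s y \<Longrightarrow> exec W E p s t s' \<Longrightarrow>
    exec W E (WhileLess x y p) s' t' s'' \<Longrightarrow>
    exec W E (WhileLess x y p) s (Suc (t + t')) s''"
| WhileFalse: "\<not> reg s x < reg s y \<Longrightarrow> exec W E (WhileLess x y p) s 1 s"

inductive_cases exec_elims:
  "exec W E (Const x c) s t s'"
  "exec W E (Copy x y) s t s'"
  "exec W E (Add x y z) s t s'"
  "exec W E (Sub x y z) s t s'"
  "exec W E (Load x a i) s t s'"
  "exec W E (Store a i x) s t s'"
  "exec W E (Query x ys) s t s'"
  "exec W E (Seq p q) s t s'"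
  "exec W E (IfLess x y p q) s t s'"
  "exec W E (WhileLess x y p) s t s'"

lemma exec_deterministic:
  "exec W E p s t s' \<Longrightarrow> exec W E p s u s'' \<Longrightarrow> t = u \<and> s' = s''"
proof (induction arbitrary: u s'' rule: exec.induct)
  case (Seq p s t s' q t' s1)
  from Seq.prems obtain t1 t2 r where
    "exec W E p s t1 r" "exec W E q r t2 s''" "u = t1 + t2"
    by (rule exec_elims)
  with Seq.IH show ?case by metis
next
  case (IfTrue s x y p t s' q)
  from IfTrue.prems obtain t1 where "exec W E p s t1 s''" "u = Suc t1"
    by (rule exec_elims) (use IfTrue.hyps in simp_all)
  with IfTrue.IH show ?case by metis
next
  case (IfFalse s x y q t s' p)
  from IfFalse.prems obtain t1 where "exec W E q s t1 s''" "u = Suc t1"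
    by (rule exec_elims) (use IfFalse.hyps in simp_all)
  with IfFalse.IH show ?case by metis
next
  case (WhileTrue s x y p t s' t' s1)
  from WhileTrue.prems obtain t1 t2 r where
    "exec W E p s t1 r" "exec W E (WhileLess x y p) r t2 s''" "u = Suc (t1 + t2)"
    by (rule exec_elims) (use WhileTrue.hyps in simp_all)
  with WhileTrue.IH show ?case by metis
next
  case (WhileFalse s x y p)
  from WhileFalse.prems show ?case
    by (rule exec_elims) (use WhileFalse.hyps in simp_all)
qed (erule exec_elims, simp)+

definition init_state :: "nat \<Rightarrow> state" where
  "init_state n = \<lparr>reg = (\<lambda>_. 0)(0 := n), arr = (\<lambda>_ _. 0)\<rparr>"

definition output_class :: "nat \<Rightarrow> nat \<Rightarrow> state \<Rightarrow> nat set" where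
  "output_class n b s = {v \<in> {1..n}. arr s 0 v = b}"

definition constructs_bipartition ::
    "nat \<Rightarrow> prog \<Rightarrow> nat \<Rightarrow> nat hypergraph \<Rightarrow> real \<Rightarrow> bool" where
  "constructs_bipartition W p n H T \<longleftrightarrow>
     (\<exists>t s. exec W (edges H) p (init_state n) t s \<and> real t \<le> T \<and>
        bipartition H (output_class n 1 s) (output_class n 0 s))"

end

theory Submission
  imports Defs "HOL-Probability.Hoeffding"
begin

text \<open>
  Fix a bipartition with both classes of size at least \<open>n / (4k)\<close> and let \<open>H\<close> be a random hypergraph
  respecting it. The number of \<open>(k - 2)\<close>-tuples completing a pair \<open>{u, v}\<close> to an edge is about
  \<open>n\<^sup>k\<^sup>-\<^sup>2 / 2\<close> if \<open>u\<close> and \<open>v\<close> are in different classes, and smaller by a constant factor if they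
  are in the same class. A single pair may deviate with probability \<open>2\<close> to the power \<open>-O(n\<^sup>k\<^sup>-\<^sup>2)\<close>, but
  the sum over a linear number of pairs through one vertex depends on about \<open>n\<^sup>k\<^sup>-\<^sup>1\<close> edges, so by a
  Chernoff bound all but a small linear number of vertices are classified correctly against every
  vertex, with failure probability \<open>2\<close> to the power \<open>-\<Omega>(n\<^sup>k\<^sup>-\<^sup>1)\<close>. Counting the vertices classified
  as equivalent both to \<open>u\<close> and to vertex 1 then decides exactly whether \<open>u\<close> and 1 share a class.
  The outcome depends on \<open>H\<close> only, so if all bipartitions of \<open>H\<close> are of this kind, there is only
  one. Since \<open>k \<ge> 3\<close>, the union bound over all \<open>2\<^sup>n\<close> bipartitions is harmless; those with a small
  class admit too few hypergraphs to matter.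
\<close>

section \<open>Deviations of random subsets and extension counts\<close>

lemma exp_plus_exp_minus_le:
  fixes y :: real
  shows "exp y + exp (- y) \<le> 2 * exp (y\<^sup>2 / 2)"
proof -
  have *: "exp y + exp (- y) \<le> 2 * exp (y\<^sup>2 / 2)" if "y \<ge> 0" for y :: real
  proof -
    define p where "p = 1 + (1/2) * (exp (2 * y) - 1)"
    have p: "p > 0" unfolding p_def by (simp add: field_simps add_pos_pos)
    \<comment> \<open>Hoeffding's lemma for a fair variable with two values at distance
      \<open>2 * y\<close>; \<open>exp (- y) * p\<close> is the hyperbolic cosine of
      \<open>y\<close>. Negative \<open>y\<close> is covered by symmetry.\<close>
    have "- (2*y) * (1/2) + ln p \<le> (2*y)\<^sup>2 / 8"
      unfolding p_def by (rule Hoeffdings_lemma_aux) (use that in auto)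
    hence "ln p \<le> y + y\<^sup>2 / 2" by (simp add: power2_eq_square)
    hence "p \<le> exp (y + y\<^sup>2 / 2)" using p by (metis exp_le_cancel_iff exp_ln)
    hence "exp (- y) * p \<le> exp (- y) * exp (y + y\<^sup>2 / 2)" by simp
    also have "\<dots> = exp (y\<^sup>2 / 2)" by (simp flip: exp_add)
    also have "exp (- y) * p = (exp (- y) + exp (- y) * exp (2 * y)) / 2"
      by (simp add: p_def field_simps)
    also have "exp (- y) * exp (2 * y) = exp y" by (simp flip: exp_add)
    finally show ?thesis by simp
  qed
  show ?thesis using *[of y] *[of "- y"] by (cases "y \<ge> 0") auto
qed

text \<open>Exponential Markov inequality for the uniform measure on \<open>Pow K\<close>. After
  centring, each \<open>e\<close> contributes \<open>a e / 2\<close> or \<open>- (a e / 2)\<close>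
  independently, so the exponential sum factorises over \<open>K\<close>. The parameter
  \<open>l\<close> is left free for later optimisation.\<close>

lemma card_subsets_deviation_le:
  fixes a :: "'a \<Rightarrow> real"
  assumes "finite K" "l \<ge> 0"
  shows "real (card {E \<in> Pow K. t < sum a E - sum a K / 2})
           \<le> 2 ^ card K * exp (l\<^sup>2 / 8 * (\<Sum>e\<in>K. (a e)\<^sup>2) - l * t)"
proof -
  let ?D = "\<lambda>E. sum a E - sum a K / 2"
  have D: "?D E = (\<Sum>e\<in>E. a e / 2) + (\<Sum>e\<in>K - E. - (a e / 2))" if "E \<in> Pow K" for E
    using that assms(1) by (auto simp: sum_diff sum_negf diff_divide_distrib simp flip: sum_divide_distrib)
  have "real (card {E \<in> Pow K. t < ?D E}) = (\<Sum>E | E \<in> Pow K \<and> t < ?D E. 1)" by simp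
  also have "\<dots> \<le> (\<Sum>E | E \<in> Pow K \<and> t < ?D E. exp (l * (?D E - t)))"
    by (intro sum_mono) (use assms in auto)
  also have "\<dots> \<le> (\<Sum>E\<in>Pow K. exp (l * (?D E - t)))"
    by (intro sum_mono2) (use assms in auto)
  also have "\<dots> = exp (- (l * t)) * (\<Sum>E\<in>Pow K. exp (l * ?D E))"
    by (simp add: sum_distrib_left right_diff_distrib flip: exp_add)
  finally have bound: "real (card {E \<in> Pow K. t < ?D E})
      \<le> exp (- (l * t)) * (\<Sum>E\<in>Pow K. exp (l * ?D E))" .
  have "(\<Sum>E\<in>Pow K. exp (l * ?D E)) =
      (\<Sum>E\<in>Pow K. (\<Prod>e\<in>E. exp (l * a e / 2)) * (\<Prod>e\<in>K - E. exp (- (l * a e / 2))))"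
  proof (rule sum.cong[OF refl])
    fix E assume E: "E \<in> Pow K"
    then have "finite E" "finite (K - E)" using assms(1) by (auto dest: finite_subset)
    then show "exp (l * ?D E) = (\<Prod>e\<in>E. exp (l * a e / 2)) * (\<Prod>e\<in>K - E. exp (- (l * a e / 2)))"
      unfolding D[OF E] by (simp add: distrib_left exp_add sum_distrib_left flip: exp_sum)
  qed
  \<comment> \<open>Independence: expanding the product of two-term factors yields one summand per
    subset of \<open>K\<close>.\<close>
  also have "\<dots> = (\<Prod>e\<in>K. exp (l * a e / 2) + exp (- (l * a e / 2)))"
    using assms(1) by (simp add: prod_add)
  also have "\<dots> \<le> (\<Prod>e\<in>K. 2 * exp ((l * a e / 2)\<^sup>2 / 2))"
    by (intro prod_mono conjI exp_plus_exp_minus_le) (simp add: add_nonneg_nonneg)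
  also have "\<dots> = 2 ^ card K * exp (l\<^sup>2 / 8 * (\<Sum>e\<in>K. (a e)\<^sup>2))"
    using assms(1)
    by (simp add: prod.distrib sum_distrib_left power_mult_distrib power_divide flip: exp_sum)
  finally have "exp (- (l * t)) * (\<Sum>E\<in>Pow K. exp (l * ?D E))
      \<le> exp (- (l * t)) * (2 ^ card K * exp (l\<^sup>2 / 8 * (\<Sum>e\<in>K. (a e)\<^sup>2)))"
    by simp
  also have "\<dots> = 2 ^ card K * exp (l\<^sup>2 / 8 * (\<Sum>e\<in>K. (a e)\<^sup>2) - l * t)"
    by (simp only: exp_diff exp_minus divide_inverse mult_ac)
  finally show ?thesis using bound by linarith
qed

lemma card_subsets_abs_deviation_le:
  fixes a :: "'a \<Rightarrow> real"
  assumes "finite K" "l \<ge> 0"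
  shows "real (card {E \<in> Pow K. t < \<bar>sum a E - sum a K / 2\<bar>})
           \<le> 2 * (2 ^ card K * exp (l\<^sup>2 / 8 * (\<Sum>e\<in>K. (a e)\<^sup>2) - l * t))"
proof -
  let ?b = "\<lambda>e. - a e"
  have "{E \<in> Pow K. t < \<bar>sum a E - sum a K / 2\<bar>} \<subseteq>
      {E \<in> Pow K. t < sum a E - sum a K / 2} \<union> {E \<in> Pow K. t < sum ?b E - sum ?b K / 2}"
    by (auto simp: sum_negf)
  then have "card {E \<in> Pow K. t < \<bar>sum a E - sum a K / 2\<bar>} \<le>
      card {E \<in> Pow K. t < sum a E - sum a K / 2} + card {E \<in> Pow K. t < sum ?b E - sum ?b K / 2}"
    using assms(1) by (intro order_trans[OF card_mono card_Un_le]) auto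
  with card_subsets_deviation_le[OF assms, of t a] card_subsets_deviation_le[OF assms, of t ?b]
  show ?thesis by simp
qed

text \<open>
  Counting ordered tuples, with repetitions allowed, makes the recursion match the nested loops of
  the program.
\<close>

fun ext_count :: "'a set \<Rightarrow> 'a set set \<Rightarrow> 'a set \<Rightarrow> nat \<Rightarrow> nat" where
  "ext_count V E A 0 = of_bool (A \<in> E)"
| "ext_count V E A (Suc m) = (\<Sum>w\<in>V. ext_count V E (insert w A) m)"

text \<open>Additivity turns any sum of extension counts into a weighted sum over edges, the form
  that the deviation bound needs.\<close>

lemma ext_count_eq_sum:
  assumes "finite E"
  shows "ext_count V E A m = (\<Sum>e\<in>E. ext_count V {e} A m)"
proof (induction m arbitrary: A)
  case 0
  show ?case using assms by (simp add: of_bool_def sum.delta)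
next
  case (Suc m)
  show ?case by (simp add: Suc[of "insert _ _"] sum.swap[of _ E V])
qed

lemma ext_count_le: "ext_count V E A m \<le> card V ^ m"
proof (induction m arbitrary: A)
  case (Suc m)
  have "(\<Sum>w\<in>V. ext_count V E (insert w A) m) \<le> card V * card V ^ m"
    using sum_bounded_above[of V "\<lambda>w. ext_count V E (insert w A) m" "card V ^ m"] Suc by simp
  then show ?case by simp
qed simp

lemma ext_count_singleton_eq_0: "\<not> A \<subseteq> e \<Longrightarrow> ext_count V {e} A m = 0"
proof (induction m arbitrary: A)
  case (Suc m)
  then have "\<not> insert w A \<subseteq> e" for w by auto
  then show ?case by (simp add: Suc.IH)
qed auto

text \<open>Tuples leaving \<open>e\<close> contribute nothing. The weight of a single edge is
  thereby bounded in terms of its size alone.\<close>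

lemma ext_count_singleton_le:
  assumes "finite V" "finite e"
  shows "ext_count V {e} A m \<le> card e ^ m"
proof (induction m arbitrary: A)
  case (Suc m)
  have "(\<Sum>w\<in>V. ext_count V {e} (insert w A) m) = (\<Sum>w\<in>V \<inter> e. ext_count V {e} (insert w A) m)"
    using assms by (intro sum.mono_neutral_right) (auto simp: ext_count_singleton_eq_0)
  also have "\<dots> \<le> card (V \<inter> e) * card e ^ m"
    using sum_bounded_above[of "V \<inter> e" "\<lambda>w. ext_count V {e} (insert w A) m" "card e ^ m"] Suc by simp
  also have "\<dots> \<le> card e * card e ^ m"
    using assms by (intro mult_right_mono card_mono) auto
  finally show ?case by simp
qed simp

text \<open>Tuples inside \<open>X\<close> never complete \<open>A\<close> to an edge. This deficit
  is what distinguishes a pair in one class from a crossing pair.\<close>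

lemma ext_count_add_power_le:
  assumes "finite V" "X \<subseteq> V" "\<forall>e\<in>E. \<not> e \<subseteq> X" "A \<subseteq> X"
  shows "ext_count V E A m + card X ^ m \<le> card V ^ m"
  using assms(4)
proof (induction m arbitrary: A)
  case 0
  then show ?case using assms(3) by auto
next
  case (Suc m)
  have fin: "finite X" using assms finite_subset by blast
  have "(\<Sum>w\<in>V. ext_count V E (insert w A) m) + card X ^ Suc m
      = (\<Sum>w\<in>X. ext_count V E (insert w A) m + card X ^ m) + (\<Sum>w\<in>V - X. ext_count V E (insert w A) m)"
    using assms(1,2) by (simp add: sum.subset_diff[of X V] sum.distrib)
  also have "\<dots> \<le> (\<Sum>w\<in>X. card V ^ m) + (\<Sum>w\<in>V - X. card V ^ m)"
    using Suc by (intro add_mono sum_mono ext_count_le Suc.IH) auto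
  also have "\<dots> = card V ^ Suc m"
    using assms(1,2) fin by (simp add: card_Diff_subset card_mono flip: distrib_right)
  finally show ?case by simp
qed

section \<open>Complete bipartite hypergraphs and their typical subsets\<close>

definition crossing :: "'a set \<Rightarrow> 'a set \<Rightarrow> nat \<Rightarrow> 'a set set" where
  "crossing V X k = {e \<in> nsets V k. e \<inter> X \<noteq> {} \<and> e - X \<noteq> {}}"

lemma finite_crossing: "finite V \<Longrightarrow> finite (crossing V X k)"
  by (simp add: crossing_def finite_imp_finite_nsets)

lemma crossing_Diff: "X \<subseteq> V \<Longrightarrow> crossing V (V - X) k = crossing V X k"
  by (auto simp: crossing_def nsets_def)

lemma power_le_ext_count_crossing:
  assumes "finite V" "A \<subseteq> V" "A \<inter> X \<noteq> {}" "A - X \<noteq> {}" "card A + m = k"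
  shows "(card V - k) ^ m \<le> ext_count V (crossing V X k) A m"
  using assms(2-)
proof (induction m arbitrary: A)
  case 0
  then show ?case using assms(1) finite_subset[of A V] by (auto simp: crossing_def nsets_def)
next
  case (Suc m)
  have finA: "finite A" using Suc assms(1) finite_subset by blast
  have "(card V - k) ^ Suc m \<le> card (V - A) * (card V - k) ^ m"
    using Suc.prems finA by (auto simp: card_Diff_subset intro!: mult_right_mono)
  also have "\<dots> = (\<Sum>w\<in>V - A. (card V - k) ^ m)" by simp
  also have "\<dots> \<le> (\<Sum>w\<in>V - A. ext_count V (crossing V X k) (insert w A) m)"
    using Suc.prems finA by (intro sum_mono Suc.IH) auto
  also have "\<dots> \<le> (\<Sum>w\<in>V. ext_count V (crossing V X k) (insert w A) m)"
    using assms(1) by (intro sum_mono2) auto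
  finally show ?case by simp
qed

text \<open>Half the count in the full crossing set is the expectation for a uniformly random
  subset. Quantifying over all \<open>S\<close> permits choosing \<open>S\<close> after
  \<open>E\<close>, as a set of misclassified vertices.\<close>

definition typical :: "'a set \<Rightarrow> 'a set \<Rightarrow> nat \<Rightarrow> real \<Rightarrow> 'a set set \<Rightarrow> bool" where
  "typical V X k d E \<longleftrightarrow> (\<forall>v\<in>V. \<forall>S\<subseteq>V.
     \<bar>\<Sum>u\<in>S. real (ext_count V E {u, v} (k - 2)) - real (ext_count V (crossing V X k) {u, v} (k - 2)) / 2\<bar>
       \<le> d * real (card V) ^ (k - 1))"

text \<open>For fixed \<open>v\<close> and \<open>S\<close> the weights \<open>a v S e\<close> lie
  between 0 and \<open>B\<close> and sum to at most \<open>N\<close>, so their squares sum to at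
  most \<open>B * N\<close>. The factor \<open>n * 2 ^ n\<close> counts the pairs of
  \<open>v\<close> and \<open>S\<close>.\<close>

lemma card_not_typical_le:
  fixes d :: real
  assumes "finite V" "k \<ge> 2" "d \<ge> 0"
  defines "n \<equiv> card V"
  shows "real (card {E \<in> Pow (crossing V X k). \<not> typical V X k d E})
    \<le> 2 ^ card (crossing V X k) *
       (2 * real n * 2 ^ n * exp (- (2 * d\<^sup>2 / real k ^ (k - 1) * real n ^ (k - 1))))"
proof -
  define K where "K = crossing V X k"
  define B where "B = real k ^ (k - 1)"
  define N where "N = real n ^ (k - 1)"
  define a where "a v S e = (\<Sum>u\<in>S. real (ext_count V {e} {u, v} (k - 2)))" for v S e
  have finK: "finite K" using assms by (simp add: K_def finite_crossing)
  have B: "B > 0" using assms by (simp add: B_def)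
  have km: "k - 1 = Suc (k - 2)" using assms by simp
  have sum_a: "(\<Sum>u\<in>S. real (ext_count V E {u, v} (k - 2))) = sum (a v S) E" if "E \<subseteq> K" for E v S
    using ext_count_eq_sum[OF finite_subset[OF that finK], of V "{_, v}" "k - 2"]
    by (simp add: a_def sum.swap[of _ E S])
  let ?bad = "\<lambda>v S. {E \<in> Pow K. d * N < \<bar>sum (a v S) E - sum (a v S) K / 2\<bar>}"
  have bad: "real (card (?bad v S)) \<le> 2 * (2 ^ card K * exp (- (2 * d\<^sup>2 / B * N)))"
    if vS: "v \<in> V" "S \<subseteq> V" for v S
  proof -
    have "a v S e \<le> B" if "e \<in> K" for e
    proof -
      have e: "finite e" "card e = k" using that by (auto simp: K_def crossing_def nsets_def)
      \<comment> \<open>The sum over \<open>u\<close> is the first level of the recursion for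
        extensions of \<open>{v}\<close>, restricted to \<open>S\<close>.\<close>
      have "(\<Sum>u\<in>S. ext_count V {e} {u, v} (k - 2)) \<le> ext_count V {e} {v} (k - 1)"
        unfolding km ext_count.simps using vS assms(1) by (intro sum_mono2) auto
      also have "\<dots> \<le> k ^ (k - 1)" using ext_count_singleton_le[OF assms(1) e(1)] e(2) by metis
      finally show ?thesis unfolding a_def B_def by (metis of_nat_le_iff of_nat_power of_nat_sum)
    qed
    moreover have a0: "a v S e \<ge> 0" for e by (simp add: a_def sum_nonneg)
    ultimately have "(\<Sum>e\<in>K. (a v S e)\<^sup>2) \<le> (\<Sum>e\<in>K. B * a v S e)"
      unfolding power2_eq_square by (intro sum_mono mult_right_mono) auto
    also have "\<dots> = B * sum (a v S) K" by (simp add: sum_distrib_left)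
    also have "sum (a v S) K \<le> N"
    proof -
      have "(\<Sum>u\<in>S. ext_count V K {u, v} (k - 2)) \<le> ext_count V K {v} (k - 1)"
        unfolding km ext_count.simps using vS assms(1) by (intro sum_mono2) auto
      also have "\<dots> \<le> n ^ (k - 1)" unfolding n_def by (rule ext_count_le)
      finally have "real (\<Sum>u\<in>S. ext_count V K {u, v} (k - 2)) \<le> real (n ^ (k - 1))"
        by (simp only: of_nat_le_iff)
      then show ?thesis by (simp add: sum_a[OF subset_refl, symmetric] N_def)
    qed
    finally have sq: "(\<Sum>e\<in>K. (a v S e)\<^sup>2) \<le> B * N" using B by simp
    \<comment> \<open>This value minimises the exponent
      \<open>l\<^sup>2 / 8 * (B * N) - l * (d * N)\<close>.\<close>
    define l where "l = 4 * d / B"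
    have "l \<ge> 0" using B assms by (simp add: l_def)
    have "l\<^sup>2 / 8 * (\<Sum>e\<in>K. (a v S e)\<^sup>2) - l * (d * N) \<le> l\<^sup>2 / 8 * (B * N) - l * (d * N)"
      using sq by (intro diff_right_mono mult_left_mono) auto
    also have "\<dots> = - (2 * d\<^sup>2 / B * N)"
      using B by (simp add: l_def power2_eq_square field_simps)
    finally have "exp (l\<^sup>2 / 8 * (\<Sum>e\<in>K. (a v S e)\<^sup>2) - l * (d * N)) \<le> exp (- (2 * d\<^sup>2 / B * N))"
      by simp
    with card_subsets_abs_deviation_le[OF finK \<open>l \<ge> 0\<close>, of "d * N" "a v S"] show ?thesis
      by (smt (verit) mult_left_mono zero_le_power)
  qed
  have "{E \<in> Pow K. \<not> typical V X k d E} \<subseteq> (\<Union>(v, S) \<in> V \<times> Pow V. ?bad v S)"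
  proof
    fix E assume E: "E \<in> {E \<in> Pow K. \<not> typical V X k d E}"
    then obtain v S where "v \<in> V" "S \<subseteq> V" and
      *: "\<not> \<bar>\<Sum>u\<in>S. real (ext_count V E {u, v} (k - 2)) - real (ext_count V K {u, v} (k - 2)) / 2\<bar> \<le> d * N"
      unfolding typical_def K_def N_def n_def by blast
    moreover have "E \<subseteq> K" using E by simp
    ultimately have "E \<in> ?bad v S"
      by (simp add: sum_subtractf sum_a flip: sum_divide_distrib)
    then show "E \<in> (\<Union>(v, S) \<in> V \<times> Pow V. ?bad v S)" using \<open>v \<in> V\<close> \<open>S \<subseteq> V\<close> by auto
  qed
  then have "card {E \<in> Pow K. \<not> typical V X k d E} \<le> card (\<Union>(v, S) \<in> V \<times> Pow V. ?bad v S)"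
    using assms(1) finK by (intro card_mono) auto
  also have "\<dots> \<le> (\<Sum>(v, S) \<in> V \<times> Pow V. card (?bad v S))"
    using assms(1) card_UN_le[of "V \<times> Pow V" "\<lambda>(v, S). ?bad v S"] by (simp add: case_prod_unfold)
  finally have "card {E \<in> Pow K. \<not> typical V X k d E} \<le> (\<Sum>(v, S) \<in> V \<times> Pow V. card (?bad v S))" .
  then have "real (card {E \<in> Pow K. \<not> typical V X k d E}) \<le> (\<Sum>(v, S) \<in> V \<times> Pow V. real (card (?bad v S)))"
    by (simp add: case_prod_unfold flip: of_nat_sum)
  also have "\<dots> \<le> (\<Sum>(v, S) \<in> V \<times> Pow V. 2 * (2 ^ card K * exp (- (2 * d\<^sup>2 / B * N))))"
    using bad by (intro sum_mono) auto
  also have "\<dots> = real (n * 2 ^ n) * (2 * (2 ^ card K * exp (- (2 * d\<^sup>2 / B * N))))"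
    using assms(1) by (simp add: case_prod_unfold card_cartesian_product card_Pow n_def)
  finally show ?thesis by (simp add: K_def B_def N_def mult_ac)
qed

section \<open>Classification by common codegrees\<close>

lemma card_nsets_containing_le:
  assumes "finite V" "x \<in> V" "0 < k"
  shows "card {e \<in> nsets V k. x \<in> e} \<le> (card V - 1) choose (k - 1)"
proof -
  have "{e \<in> nsets V k. x \<in> e} \<subseteq> insert x ` nsets (V - {x}) (k - 1)"
  proof
    fix e assume e: "e \<in> {e \<in> nsets V k. x \<in> e}"
    then have "e - {x} \<in> nsets (V - {x}) (k - 1)" "e = insert x (e - {x})" by (auto simp: nsets_def)
    then show "e \<in> insert x ` nsets (V - {x}) (k - 1)" by blast
  qed
  then have "card {e \<in> nsets V k. x \<in> e} \<le> card (nsets (V - {x}) (k - 1))"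
    using assms by (intro surj_card_le) (auto simp: finite_imp_finite_nsets)
  then show ?thesis using assms by (simp add: card_nsets)
qed

text \<open>Every crossing edge contains a vertex of \<open>X\<close>, and a given vertex lies in a
  fraction \<open>k / card V\<close> of all \<open>k\<close>-sets.\<close>

lemma card_crossing_le:
  assumes "finite V" "X \<subseteq> V" "0 < k" "4 * k * card X < card V"
  shows "4 * card (crossing V X k) \<le> card V choose k"
proof -
  let ?n = "card V"
  have fin: "finite X" using assms finite_subset by blast
  have "crossing V X k \<subseteq> (\<Union>x\<in>X. {e \<in> nsets V k. x \<in> e})" by (auto simp: crossing_def)
  then have "card (crossing V X k) \<le> card (\<Union>x\<in>X. {e \<in> nsets V k. x \<in> e})"
    using assms fin by (intro card_mono) (auto simp: finite_imp_finite_nsets)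
  also have "\<dots> \<le> (\<Sum>x\<in>X. card {e \<in> nsets V k. x \<in> e})" by (rule card_UN_le[OF fin])
  also have "\<dots> \<le> (\<Sum>x\<in>X. (?n - 1) choose (k - 1))"
    using assms by (intro sum_mono card_nsets_containing_le) auto
  also have "\<dots> = card X * ((?n - 1) choose (k - 1))" by simp
  finally have "4 * card (crossing V X k) * ?n \<le> 4 * (card X * ((?n - 1) choose (k - 1))) * ?n"
    by (intro mult_right_mono mult_left_mono) auto
  also have "\<dots> = 4 * card X * (?n * ((?n - 1) choose (k - 1)))" by (simp add: mult_ac)
  also have "\<dots> = 4 * card X * (k * (?n choose k))"
    using times_binomial_minus1_eq[OF assms(3), of ?n] by simp
  also have "\<dots> = (4 * k * card X) * (?n choose k)" by (simp add: mult_ac)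
  also have "\<dots> \<le> ?n * (?n choose k)" using assms(4) by (intro mult_right_mono) auto
  finally show ?thesis using assms(4) by (simp add: mult.commute)
qed

text \<open>Averaging over all \<open>X\<close>: a fixed \<open>k\<close>-set fails to cross for a
  fraction \<open>2 / 2 ^ k\<close> of them, which is at most a quarter.\<close>

lemma ex_card_crossing_ge:
  assumes "finite V" "3 \<le> k"
  shows "\<exists>X\<subseteq>V. 3 * (card V choose k) \<le> 4 * card (crossing V X k)"
proof (rule ccontr)
  let ?n = "card V"
  let ?K = "\<lambda>X. crossing V X k"
  let ?C = "\<lambda>e. {X \<in> Pow V. e \<inter> X \<noteq> {} \<and> e - X \<noteq> {}}"
  assume "\<not> ?thesis"
  then have *: "4 * card (?K X) < 3 * (?n choose k)" if "X \<in> Pow V" for X using that by auto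
  have cross: "3 * 2 ^ ?n \<le> 4 * card (?C e)" if e: "e \<in> nsets V k" for e
  proof -
    have e': "e \<subseteq> V" "finite e" "card e = k" using e by (auto simp: nsets_def)
    have le: "k \<le> ?n" using e' assms card_mono by blast
    \<comment> \<open>A set that does not split \<open>e\<close> either avoids \<open>e\<close> or
      contains it.\<close>
    have "Pow V \<subseteq> ?C e \<union> Pow (V - e) \<union> (\<union>) e ` Pow (V - e)"
    proof
      fix X assume "X \<in> Pow V"
      moreover have "X \<in> (\<union>) e ` Pow (V - e)" if "e \<subseteq> X" "X \<subseteq> V"
        using that by (intro image_eqI[of _ _ "X - e"]) auto
      ultimately show "X \<in> ?C e \<union> Pow (V - e) \<union> (\<union>) e ` Pow (V - e)" by blast
    qed
    then have "card (Pow V) \<le> card (?C e \<union> Pow (V - e) \<union> (\<union>) e ` Pow (V - e))"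
      using assms by (intro card_mono) auto
    also have "\<dots> \<le> card (?C e \<union> Pow (V - e)) + card ((\<union>) e ` Pow (V - e))" by (rule card_Un_le)
    also have "\<dots> \<le> card (?C e) + card (Pow (V - e)) + card (Pow (V - e))"
      using assms by (intro add_mono card_Un_le card_image_le) auto
    also have "card (Pow (V - e)) = 2 ^ (?n - k)"
      using assms e' by (simp add: card_Pow card_Diff_subset)
    finally have 1: "2 ^ ?n \<le> card (?C e) + 2 * 2 ^ (?n - k)" using assms by (simp add: card_Pow)
    have "(2::nat) ^ 3 * 2 ^ (?n - k) \<le> 2 ^ k * 2 ^ (?n - k)"
      using assms by (intro mult_right_mono power_increasing) auto
    also have "\<dots> = 2 ^ ?n" using le by (simp flip: power_add)
    finally show ?thesis using 1 by simp
  qed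
  have fin: "finite (nsets V k)" using assms by (simp add: finite_imp_finite_nsets)
  have "(\<Sum>X\<in>Pow V. card (?K X)) = (\<Sum>X\<in>Pow V. \<Sum>e\<in>nsets V k. of_bool (e \<inter> X \<noteq> {} \<and> e - X \<noteq> {}))"
    using fin by (intro sum.cong) (auto simp: crossing_def Int_def intro!: arg_cong[of _ _ card])
  also have "\<dots> = (\<Sum>e\<in>nsets V k. \<Sum>X\<in>Pow V. of_bool (e \<inter> X \<noteq> {} \<and> e - X \<noteq> {}))" by (rule sum.swap)
  also have "\<dots> = (\<Sum>e\<in>nsets V k. card (?C e))"
    using assms by (intro sum.cong) (auto simp: Int_def intro!: arg_cong[of _ _ card])
  finally have eq: "(\<Sum>X\<in>Pow V. card (?K X)) = (\<Sum>e\<in>nsets V k. card (?C e))" .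
  have "3 * 2 ^ ?n * (?n choose k) = (\<Sum>e\<in>nsets V k. 3 * 2 ^ ?n)" by (simp add: card_nsets)
  also have "\<dots> \<le> (\<Sum>e\<in>nsets V k. 4 * card (?C e))" by (intro sum_mono cross)
  also have "\<dots> = (\<Sum>X\<in>Pow V. 4 * card (?K X))" using eq by (simp flip: sum_distrib_left)
  also have "\<dots> < (\<Sum>X\<in>Pow V. 3 * (?n choose k))"
    using assms * by (intro sum_strict_mono) auto
  also have "\<dots> = 3 * 2 ^ ?n * (?n choose k)" using assms by (simp add: card_Pow)
  finally show False by simp
qed

text \<open>Write \<open>N\<close> for \<open>n ^ (k - 2)\<close>. Balance gives
  \<open>card X ^ (k - 2)\<close> \<ge> \<open>N / g\<close>, so the expected count is at most
  \<open>N / 2 - N / (2 * g)\<close> within the class, and at least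
  \<open>N / 2 - N / (8 * g)\<close> across. The threshold \<open>N / 2 - N / (4 * g)\<close> lies
  between, and \<open>4 * g\<close> clears its denominator.\<close>

lemma card_misclassified_le:
  fixes V X :: "'a set" and k :: nat
  defines "n \<equiv> card V" and "g \<equiv> (4 * k) ^ (k - 2)"
  assumes "finite V" "X \<subseteq> V" "v \<in> X" "3 \<le> k" "n \<le> 4 * k * card X"
    and large: "4 * g * k\<^sup>2 \<le> n" and pos: "0 < n"
    and typic: "typical V X k (1 / (384 * real k * real g)) E"
  shows "32 * k * card {u \<in> V. (4 * g * ext_count V E {u, v} (k - 2) < (2 * g - 1) * n ^ (k - 2)) \<noteq> (u \<in> X)} \<le> n"
proof -
  define m where "m = k - 2"
  define N where "N = real n ^ m"
  let ?K = "crossing V X k"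
  let ?low = "\<lambda>u. 4 * g * ext_count V E {u, v} m < (2 * g - 1) * n ^ m"
  define f where "f u = real (ext_count V E {u, v} m) - real (ext_count V ?K {u, v} m) / 2" for u
  have k: "k = m + 2" "0 < k" using assms by (auto simp: m_def)
  have g: "0 < g" using k by (simp add: g_def)
  have N: "N > 0" using assms by (simp add: N_def)
  have dev: "\<bar>sum f S\<bar> \<le> 1 / (384 * real k * real g) * (N * real n)" if "S \<subseteq> V" for S
  proof -
    have "k - 1 = Suc m" using k by simp
    then show ?thesis using typic that \<open>v \<in> X\<close> \<open>X \<subseteq> V\<close> unfolding typical_def f_def N_def n_def m_def
      by (auto simp: mult_ac)
  qed
  have low: "?low u \<longleftrightarrow> 4 * real g * real (ext_count V E {u, v} m) < (2 * real g - 1) * N" for u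
  proof -
    have "?low u \<longleftrightarrow> real (4 * g * ext_count V E {u, v} m) < real ((2 * g - 1) * n ^ m)"
      by (simp only: of_nat_less_iff)
    then show ?thesis using g by (simp add: N_def of_nat_diff)
  qed
  \<comment> \<open>The two kinds of error are summed separately to avoid cancellation: on
    \<open>S1\<close> each deviation is at least \<open>N / (4 * g)\<close>, on \<open>S2\<close> at
    most \<open>- (N / (8 * g))\<close>.\<close>
  define S1 where "S1 = {u \<in> X. \<not> ?low u}"
  define S2 where "S2 = {u \<in> V - X. ?low u}"
  have fin: "finite S1" "finite S2" using assms finite_subset[of X V] by (auto simp: S1_def S2_def)
  have "real (card S1) * (N / (4 * real g)) = (\<Sum>u\<in>S1. N / (4 * real g))" by simp
  also have "\<dots> \<le> sum f S1"
  proof (rule sum_mono)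
    fix u assume u: "u \<in> S1"
    have "ext_count V ?K {u, v} m + card X ^ m \<le> n ^ m"
      unfolding n_def using assms u by (intro ext_count_add_power_le) (auto simp: crossing_def S1_def)
    then have "real (ext_count V ?K {u, v} m + card X ^ m) \<le> real (n ^ m)" by (simp only: of_nat_le_iff)
    then have 1: "real (ext_count V ?K {u, v} m) + real (card X) ^ m \<le> N" by (simp add: N_def)
    have "n ^ m \<le> (4 * k * card X) ^ m" using assms by (intro power_mono) auto
    then have "n ^ m \<le> g * card X ^ m" by (simp add: g_def m_def power_mult_distrib)
    then have "real (n ^ m) \<le> real (g * card X ^ m)" by (simp only: of_nat_le_iff)
    then have 2: "N / real g \<le> real (card X) ^ m" using g by (simp add: N_def field_simps)
    have "(2 * real g - 1) * N \<le> 4 * real g * real (ext_count V E {u, v} m)"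
      using u low[of u] by (simp add: S1_def)
    then have "((2 * real g - 1) * N) / (4 * real g) \<le> real (ext_count V E {u, v} m)"
      using g by (simp add: field_simps)
    moreover have "((2 * real g - 1) * N) / (4 * real g) = N / 2 - N / (4 * real g)"
      using g by (simp add: field_simps)
    moreover have "N / real g / 2 - N / (4 * real g) = N / (4 * real g)" using g by (simp add: field_simps)
    ultimately show "N / (4 * real g) \<le> f u" unfolding f_def using 1 2 by linarith
  qed
  also have "\<dots> \<le> 1 / (384 * real k * real g) * (N * real n)"
    by (rule order_trans[OF abs_ge_self dev]) (use \<open>X \<subseteq> V\<close> in \<open>auto simp: S1_def\<close>)
  finally have S1: "96 * real k * real (card S1) \<le> real n"
    using g N k(2) by (simp add: field_simps)
  have "real (card S2) * (N / (8 * real g)) = (\<Sum>u\<in>S2. N / (8 * real g))" by simp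
  also have "\<dots> \<le> (\<Sum>u\<in>S2. - f u)"
  proof (rule sum_mono)
    fix u assume u: "u \<in> S2"
    have "(n - k) ^ m \<le> ext_count V ?K {u, v} m"
      unfolding n_def using assms u k by (intro power_le_ext_count_crossing) (auto simp: S2_def card_insert_if)
    then have 1: "real (n - k) ^ m \<le> real (ext_count V ?K {u, v} m)" by (metis of_nat_le_iff of_nat_power)
    \<comment> \<open>This makes \<open>m * k / n\<close> at most \<open>1 / (4 * g)\<close>, so
      Bernoulli's inequality bounds the loss from \<open>n ^ m\<close> to
      \<open>(n - k) ^ m\<close>.\<close>
    have kk: "real m * real k * (4 * real g) \<le> real n"
    proof -
      have "m * k * (4 * g) \<le> k * k * (4 * g)" using k(1) by (intro mult_right_mono) auto
      also have "\<dots> = 4 * g * k\<^sup>2" by (simp add: power2_eq_square)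
      also have "\<dots> \<le> n" by (rule large)
      finally have "m * k * (4 * g) \<le> n" .
      then show ?thesis by (metis of_nat_le_iff of_nat_mult of_nat_numeral)
    qed
    have kn: "k \<le> n"
    proof -
      have "k * 1 \<le> k * (4 * g * k)" using g k by (intro mult_left_mono) auto
      also have "\<dots> = 4 * g * k\<^sup>2" by (simp add: power2_eq_square)
      finally show ?thesis using large by simp
    qed
    have "real m * real k / real n \<le> 1 / (4 * real g)" using kk g pos by (simp add: field_simps)
    then have "1 - 1 / (4 * real g) \<le> 1 + real m * (- real k / real n)" by simp
    moreover have "1 + real m * (- real k / real n) \<le> (1 + - real k / real n) ^ m"
      using kn pos by (intro Bernoulli_inequality) (simp add: field_simps)
    moreover have base: "(1 + - real k / real n) * real n = real (n - k)"
      using kn pos by (simp add: of_nat_diff field_simps)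
    ultimately have "(1 - 1 / (4 * real g)) * N \<le> (1 + - real k / real n) ^ m * N"
      using N by simp
    also have "\<dots> = real (n - k) ^ m"
      unfolding N_def power_mult_distrib[symmetric] base ..
    finally have 2: "N - N / (4 * real g) \<le> real (n - k) ^ m" by (simp add: algebra_simps)
    have "4 * real g * real (ext_count V E {u, v} m) \<le> (2 * real g - 1) * N"
      using u low[of u] by (simp add: S2_def)
    then have "real (ext_count V E {u, v} m) \<le> ((2 * real g - 1) * N) / (4 * real g)"
      using g by (simp add: field_simps)
    moreover have "((2 * real g - 1) * N) / (4 * real g) = N / 2 - N / (4 * real g)"
      using g by (simp add: field_simps)
    moreover have "N / (4 * real g) / 2 = N / (8 * real g)"
      "N / (4 * real g) = N / (8 * real g) + N / (8 * real g)" using g by (auto simp: field_simps)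
    ultimately show "N / (8 * real g) \<le> - f u" unfolding f_def using 1 2 by linarith
  qed
  also have "\<dots> \<le> \<bar>sum f S2\<bar>" by (simp add: sum_negf)
  also have "\<dots> \<le> 1 / (384 * real k * real g) * (N * real n)"
    using dev[of S2] by (auto simp: S2_def)
  finally have S2: "48 * real k * real (card S2) \<le> real n"
    using g N k(2) by (simp add: field_simps)
  have "{u \<in> V. ?low u \<noteq> (u \<in> X)} = S1 \<union> S2" using assms by (auto simp: S1_def S2_def)
  then have "card {u \<in> V. ?low u \<noteq> (u \<in> X)} \<le> card S1 + card S2" by (simp add: card_Un_le)
  then have "real (card {u \<in> V. ?low u \<noteq> (u \<in> X)}) \<le> real (card S1) + real (card S2)" by linarith
  then have "32 * real k * real (card {u \<in> V. ?low u \<noteq> (u \<in> X)})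
      \<le> 32 * real k * (real (card S1) + real (card S2))"
    by (intro mult_left_mono) auto
  \<comment> \<open>The constant 384 lets \<open>S1\<close> use one third and \<open>S2\<close> two
    thirds of the allowance.\<close>
  also have "\<dots> \<le> real n" using S1 S2 by (simp add: algebra_simps)
  finally have "real (32 * k * card {u \<in> V. ?low u \<noteq> (u \<in> X)}) \<le> real n" by simp
  then show ?thesis unfolding m_def by (simp only: of_nat_le_iff)
qed

text \<open>Each vertex has at most \<open>n / (32 * k)\<close> erroneous tests, so those of
  \<open>u\<close> and \<open>x\<close> together number at most \<open>n / (16 * k)\<close>. If
  \<open>u\<close> is in \<open>X\<close>, the common set is \<open>X\<close> up to these errors and
  has at least \<open>3 * n / (16 * k)\<close> elements; otherwise it consists of errors only. The
  left-hand side does not mention \<open>X\<close>.\<close>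

lemma mem_class_iff_common_low:
  fixes V X :: "'a set" and k :: nat
  defines "n \<equiv> card V" and "g \<equiv> (4 * k) ^ (k - 2)"
  defines "low \<equiv> \<lambda>E u v. 4 * g * ext_count V E {u, v} (k - 2) < (2 * g - 1) * n ^ (k - 2)"
  assumes V: "finite V" "X \<subseteq> V" "x \<in> X" "u \<in> V" and k: "3 \<le> k"
    and n: "n \<le> 4 * k * card X" "n \<le> 4 * k * card (V - X)" "4 * g * k\<^sup>2 \<le> n" "0 < n"
    and typic: "typical V X k (1 / (384 * real k * real g)) E"
  shows "n < 8 * k * card {v \<in> V. low E u v \<and> low E x v} \<longleftrightarrow> u \<in> X"
proof -
  define err where "err v = {u \<in> V. low E v u \<noteq> (u \<in> X \<longleftrightarrow> v \<in> X)}" for v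
  have comm: "low E v u = low E u v" for u v by (simp add: low_def insert_commute)
  have fin: "finite (err v)" for v using V by (simp add: err_def)
  have err: "32 * k * card (err v) \<le> n" if "v \<in> V" for v
  proof (cases "v \<in> X")
    case True
    then have "err v = {u \<in> V. low E u v \<noteq> (u \<in> X)}" by (auto simp: err_def comm)
    then show ?thesis
      using card_misclassified_le[of V X v k E] True V k n typic by (simp add: low_def n_def g_def)
  next
    case False
    \<comment> \<open>The misclassification bound concerns a vertex of the named class; crossing
      edges are symmetric in the two classes.\<close>
    have "typical V (V - X) k (1 / (384 * real k * real g)) E"
      using typic V by (simp add: typical_def crossing_Diff)
    moreover have "err v = {u \<in> V. low E u v \<noteq> (u \<in> V - X)}" using False by (auto simp: err_def comm)
    ultimately show ?thesis
      using card_misclassified_le[of V "V - X" v k E] False that V k n by (simp add: low_def n_def g_def)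
  qed
  let ?C = "{v \<in> V. low E u v \<and> low E x v}"
  have two: "16 * k * (card (err u) + card (err x)) \<le> n"
    using err[of u] err[of x] V by (simp add: algebra_simps subset_iff)
  show ?thesis
  proof
    assume "u \<in> X"
    have "X \<subseteq> ?C \<union> err u \<union> err x" using V \<open>u \<in> X\<close> by (auto simp: err_def)
    then have "card X \<le> card (?C \<union> err u \<union> err x)" using V fin by (intro card_mono) auto
    also have "\<dots> \<le> card ?C + (card (err u) + card (err x))"
      using card_Un_le[of "?C \<union> err u" "err x"] card_Un_le[of ?C "err u"] by simp
    finally have "16 * k * card X \<le> 16 * k * card ?C + 16 * k * (card (err u) + card (err x))"
      by (metis add_mult_distrib2 mult_le_mono2)
    moreover have "4 * n \<le> 16 * k * card X" using n by simp
    ultimately have "3 * n \<le> 2 * (8 * k * card ?C)" using two by simp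
    then show "n < 8 * k * card ?C" using n(4) by linarith
  next
    assume *: "n < 8 * k * card ?C"
    show "u \<in> X"
    proof (rule ccontr)
      assume "u \<notin> X"
      then have "?C \<subseteq> err u \<union> err x" using V by (auto simp: err_def)
      then have "card ?C \<le> card (err u \<union> err x)" using fin by (intro card_mono) auto
      also have "\<dots> \<le> card (err u) + card (err x)" by (rule card_Un_le)
      finally have "16 * k * card ?C \<le> 16 * k * (card (err u) + card (err x))" by (rule mult_le_mono2)
      then show False using two * by linarith
    qed
  qed
qed

section \<open>The program\<close>

definition runs :: "nat \<Rightarrow> nat set set \<Rightarrow> prog \<Rightarrow> state \<Rightarrow> nat \<Rightarrow> (state \<Rightarrow> bool) \<Rightarrow> bool" where
  "runs W E p s T Q \<longleftrightarrow> (\<exists>t s'. exec W E p s t s' \<and> t \<le> T \<and> Q s')"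

lemma runs_mono: "runs W E p s T Q \<Longrightarrow> T \<le> T' \<Longrightarrow> (\<And>s'. Q s' \<Longrightarrow> Q' s') \<Longrightarrow> runs W E p s T' Q'"
  unfolding runs_def by (meson order_trans)

lemma runs_Const: "c \<le> W \<Longrightarrow> Q (set_reg x c s) \<Longrightarrow> runs W E (Const x c) s (Suc T) Q"
  unfolding runs_def using exec.Const by (fastforce simp del: fun_upd_apply)

lemma runs_Copy: "Q (set_reg x (reg s y) s) \<Longrightarrow> runs W E (Copy x y) s (Suc T) Q"
  unfolding runs_def using exec.Copy by (fastforce simp del: fun_upd_apply)

lemma runs_Add:
  "reg s y + reg s z \<le> W \<Longrightarrow> Q (set_reg x (reg s y + reg s z) s) \<Longrightarrow> runs W E (Add x y z) s (Suc T) Q"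
  unfolding runs_def using exec.Add by (fastforce simp del: fun_upd_apply)

lemma runs_Store:
  "Q (s\<lparr>arr := (arr s)(a := (arr s a)(reg s i := reg s x))\<rparr>) \<Longrightarrow> runs W E (Store a i x) s (Suc T) Q"
  unfolding runs_def using exec.Store by (fastforce simp del: fun_upd_apply)

lemma runs_Query:
  "Q (set_reg x (if reg s ` set ys \<in> E then 1 else 0) s) \<Longrightarrow> runs W E (Query x ys) s (Suc T) Q"
  unfolding runs_def using exec.Query by (fastforce simp del: fun_upd_apply)

lemma runs_Seq:
  "runs W E p s T1 (\<lambda>s'. runs W E q s' T2 Q) \<Longrightarrow> T1 + T2 \<le> T \<Longrightarrow> runs W E (Seq p q) s T Q"
  unfolding runs_def using exec.Seq by (meson add_mono order_trans)

lemma runs_IfLess: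
  assumes "reg s x < reg s y \<Longrightarrow> runs W E p s T Q" "\<not> reg s x < reg s y \<Longrightarrow> runs W E q s T Q"
  shows "runs W E (IfLess x y p q) s (Suc T) Q"
  using assms exec.IfTrue exec.IfFalse unfolding runs_def by (meson Suc_le_mono)

text \<open>Registers 0 and 1 hold \<open>n\<close> and 1; the body sees the loop variable run through \<open>1, \<dots>, n\<close>.\<close>

definition For :: "nat \<Rightarrow> prog \<Rightarrow> prog" where
  "For i p = Seq (Const i 0) (WhileLess i 0 (Seq (Add i i 1) p))"

text \<open>\<open>I j\<close> describes the state after \<open>j\<close> rounds. Test, increment
  and body cost \<open>T + 2\<close> per round; the initial assignment and the last test are
  absorbed in \<open>T + 4\<close> because \<open>0 < n\<close>.\<close>

lemma runs_For:
  assumes "0 < n" "n \<le> W"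
    and regs: "\<And>j s. I j s \<Longrightarrow> reg s 0 = n \<and> reg s 1 = 1"
    and init: "I 0 (set_reg i 0 s)"
    and step: "\<And>j s. j < n \<Longrightarrow> I j s \<Longrightarrow>
      runs W E p (set_reg i (Suc j) s) T (\<lambda>s'. I (Suc j) s' \<and> reg s' i = Suc j)"
  shows "runs W E (For i p) s (n * (T + 4)) (I n)"
proof -
  let ?w = "WhileLess i 0 (Seq (Add i i 1) p)"
  have loop: "runs W E ?w s (1 + (n - j) * (T + 2)) (I n)" if "j \<le> n" "I j s" "reg s i = j" for j s
    using that
  proof (induction "n - j" arbitrary: j s)
    case 0
    then have "exec W E ?w s 1 s" using regs[of j s] by (intro exec.WhileFalse) auto
    then show ?case using 0 unfolding runs_def by auto
  next
    case (Suc m)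
    have j: "j < n" using Suc by simp
    have R: "reg s 0 = n" "reg s 1 = 1" using regs[of j s] Suc by auto
    obtain t s1 where s1: "exec W E p (set_reg i (Suc j) s) t s1" "t \<le> T" "I (Suc j) s1" "reg s1 i = Suc j"
      using step[OF j \<open>I j s\<close>] unfolding runs_def by auto
    have "exec W E (Add i i 1) s 1 (set_reg i (Suc j) s)"
      using exec.Add[of s i 1 W E i] R Suc.prems j assms(2) by simp
    then have body: "exec W E (Seq (Add i i 1) p) s (1 + t) s1" using s1 by (intro exec.Seq)
    have "runs W E ?w s1 (1 + (n - Suc j) * (T + 2)) (I n)"
      by (rule Suc.hyps) (use Suc s1 in auto)
    then obtain t' s2 where s2: "exec W E ?w s1 t' s2" "t' \<le> 1 + (n - Suc j) * (T + 2)" "I n s2"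
      unfolding runs_def by auto
    have "exec W E ?w s (Suc (1 + t + t')) s2"
      by (rule exec.WhileTrue[OF _ body s2(1)]) (use R j Suc.prems in simp)
    moreover have "Suc (1 + t + t') \<le> 1 + (n - j) * (T + 2)"
    proof -
      have "n - j = Suc (n - Suc j)" using j by simp
      then show ?thesis using s1 s2 by simp
    qed
    ultimately show ?case using s2 unfolding runs_def by blast
  qed
  have "runs W E ?w (set_reg i 0 s) (1 + (n - 0) * (T + 2)) (I n)" by (rule loop) (use init in auto)
  moreover have "1 + (1 + (n - 0) * (T + 2)) \<le> n * (T + 4)" using \<open>0 < n\<close> by (simp add: algebra_simps)
  ultimately show ?thesis unfolding For_def
    by (intro runs_Seq[where ?T1.0 = "Suc 0"] runs_Const) auto
qed

text \<open>
  Registers: 0 and 1 as above, 2 constantly zero, 3--5 constants, 6 the answer to the last query,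
  7 and 8 the two sides of the codegree test, 9 the common neighbour count, 10 and 11 the
  vertices \<open>u\<close> and \<open>v\<close>, 12 onwards the remaining \<open>k - 2\<close> vertices of a potential edge. Both sides of
  the codegree test are accumulated by repeated addition, since there is no multiplication.
\<close>

fun count_prog :: "nat list \<Rightarrow> nat \<Rightarrow> prog" where
  "count_prog ys 0 =
     Seq (Query 6 ys) (Seq (IfLess 2 6 (Add 7 7 3) (Copy 6 6)) (Add 8 8 4))"
| "count_prog ys (Suc m) = For (12 + m) (count_prog ((12 + m) # ys) m)"

text \<open>The innermost block costs 4 operations, with \<open>Copy 6 6\<close> as a no-op. Each
  loop level adds 4 per round, at most \<open>4 * n ^ m\<close>. Level \<open>Suc m\<close> loops on
  register \<open>12 + m\<close> and inner levels use smaller ones, whence the frame. The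
  accumulators only grow, so the word limit need be assumed for their final bounds only.\<close>

lemma runs_count_prog:
  assumes "0 < n" "n \<le> W" "reg s 0 = n" "reg s 1 = 1" "reg s 2 = 0" "reg s 3 = a" "reg s 4 = b"
    and "set ys \<inter> ({6, 7, 8} \<union> {12..<12 + m}) = {}"
    and "reg s 7 + a * n ^ m \<le> W" "reg s 8 + b * n ^ m \<le> W"
  shows "runs W E (count_prog ys m) s ((4 + 4 * m) * n ^ m) (\<lambda>s'.
     reg s' 7 = reg s 7 + a * ext_count {1..n} E (reg s ` set ys) m \<and>
     reg s' 8 = reg s 8 + b * n ^ m \<and> arr s' = arr s \<and>
     (\<forall>r. r \<notin> {6, 7, 8} \<union> {12..<12 + m} \<longrightarrow> reg s' r = reg s r))"
  using assms
proof (induction m arbitrary: ys s)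
  case 0
  show ?case unfolding count_prog.simps
    apply (rule runs_Seq[where ?T1.0 = "Suc 0" and ?T2.0 = 3])
     apply (rule runs_Query)
     apply (rule runs_Seq[where ?T1.0 = "Suc (Suc 0)" and ?T2.0 = "Suc 0"])
      apply (rule runs_IfLess)
       apply (rule runs_Add)
    using 0 apply (auto intro!: runs_Add runs_Copy split: if_splits)
    done
next
  case (Suc m)
  define frame where "frame = - ({6::nat, 7, 8} \<union> {12..<12 + Suc m})"
  define I where "I j s' \<longleftrightarrow>
     reg s' 7 = reg s 7 + a * (\<Sum>w\<in>{1..j}. ext_count {1..n} E (insert w (reg s ` set ys)) m) \<and>
     reg s' 8 = reg s 8 + b * (j * n ^ m) \<and> arr s' = arr s \<and> (\<forall>r\<in>frame. reg s' r = reg s r)" for j and s' :: state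
  have fr: "{0,1,2,3,4} \<subseteq> frame" by (auto simp: frame_def)
  have ys: "set ys \<subseteq> frame" "12 + m \<notin> set ys" using Suc.prems(8) by (auto simp: frame_def)
  have "runs W E (For (12 + m) (count_prog ((12 + m) # ys) m)) s (n * ((4 + 4 * m) * n ^ m + 4)) (I n)"
  proof (rule runs_For)
    show "reg s' 0 = n \<and> reg s' 1 = 1" if "I j s'" for j s'
      using that fr Suc.prems by (auto simp: I_def)
    show "I 0 (set_reg (12 + m) 0 s)" by (auto simp: I_def frame_def)
    fix j s' assume j: "j < n" and I: "I j s'"
    let ?s = "set_reg (12 + m) (Suc j) s'"
    have "reg ?s x = reg s x" if "x \<in> set ys" for x
      using I ys that by (auto simp: I_def)
    then have "reg ?s ` set ys = reg s ` set ys" by (rule image_cong[OF refl])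
    moreover have "reg ?s (12 + m) = Suc j" by simp
    ultimately have img: "reg ?s ` set ((12 + m) # ys) = insert (Suc j) (reg s ` set ys)"
      by (simp only: list.set image_insert)
    have regs: "\<And>r. r < 6 \<Longrightarrow> reg ?s r = reg s r" using I by (auto simp: I_def frame_def)
    \<comment> \<open>The trivial bound on the partial sum leaves room in both words for one more
      inner run.\<close>
    have sum_le: "(\<Sum>w\<in>{1..j}. ext_count {1..n} E (insert w (reg s ` set ys)) m) \<le> j * n ^ m"
      using sum_bounded_above[of "{1..j}" "\<lambda>w. ext_count {1..n} E (insert w (reg s ` set ys)) m" "n ^ m"]
        ext_count_le[of "{1..n}" E _ m] by simp
    have Sj: "Suc j * n ^ m \<le> n ^ Suc m" using j by (simp del: mult_Suc)
    have W7: "reg ?s 7 + a * n ^ m \<le> W"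
    proof -
      have "reg ?s 7 + a * n ^ m \<le> reg s 7 + a * (j * n ^ m) + a * n ^ m"
        using I sum_le by (simp add: I_def)
      also have "\<dots> = reg s 7 + a * (Suc j * n ^ m)" by (simp add: algebra_simps)
      also have "\<dots> \<le> reg s 7 + a * n ^ Suc m" using Sj by (intro add_left_mono mult_left_mono) auto
      finally show ?thesis using Suc.prems by linarith
    qed
    have W8: "reg ?s 8 + b * n ^ m \<le> W"
    proof -
      have "reg ?s 8 + b * n ^ m = reg s 8 + b * (Suc j * n ^ m)"
        using I by (simp add: I_def algebra_simps)
      also have "\<dots> \<le> reg s 8 + b * n ^ Suc m" using Sj by (intro add_left_mono mult_left_mono) auto
      finally show ?thesis using Suc.prems by linarith
    qed
    have "runs W E (count_prog ((12 + m) # ys) m) ?s ((4 + 4 * m) * n ^ m) (\<lambda>s''.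
        reg s'' 7 = reg ?s 7 + a * ext_count {1..n} E (reg ?s ` set ((12 + m) # ys)) m \<and>
        reg s'' 8 = reg ?s 8 + b * n ^ m \<and> arr s'' = arr ?s \<and>
        (\<forall>r. r \<notin> {6, 7, 8} \<union> {12..<12 + m} \<longrightarrow> reg s'' r = reg ?s r))"
      by (rule Suc.IH) (use Suc.prems regs W7 W8 in auto)
    then show "runs W E (count_prog ((12 + m) # ys) m) ?s ((4 + 4 * m) * n ^ m)
        (\<lambda>s''. I (Suc j) s'' \<and> reg s'' (12 + m) = Suc j)"
    proof (rule runs_mono)
      fix s'' :: state assume H: "reg s'' 7 = reg ?s 7 + a * ext_count {1..n} E (reg ?s ` set ((12 + m) # ys)) m \<and>
        reg s'' 8 = reg ?s 8 + b * n ^ m \<and> arr s'' = arr ?s \<and>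
        (\<forall>r. r \<notin> {6, 7, 8} \<union> {12..<12 + m} \<longrightarrow> reg s'' r = reg ?s r)"
      then have "reg s'' (12 + m) = Suc j" by simp
      moreover have "reg s'' r = reg s r" if r: "r \<in> frame" for r
      proof -
        have r': "r \<notin> {6, 7, 8} \<union> {12..<12 + m}" "r \<noteq> 12 + m" using r by (auto simp: frame_def)
        then have "reg s'' r = reg ?s r" using H by blast
        also have "\<dots> = reg s r" using r r' I by (simp add: I_def)
        finally show ?thesis .
      qed
      moreover have "reg s'' 7 = reg s' 7 + a * ext_count {1..n} E (insert (Suc j) (reg s ` set ys)) m"
        using H unfolding img by simp
      moreover have "reg s'' 8 = reg s' 8 + b * n ^ m" "arr s'' = arr s'" using H by simp_all
      ultimately show "I (Suc j) s'' \<and> reg s'' (12 + m) = Suc j"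
        using I by (simp add: I_def algebra_simps)
    qed simp
  qed (use Suc.prems in auto)
  then show ?case unfolding count_prog.simps
  proof (rule runs_mono)
    have "1 \<le> n ^ m" using \<open>0 < n\<close> by simp
    then have "(4 + 4 * m) * n ^ m + 4 \<le> (4 + 4 * Suc m) * n ^ m" by (simp add: algebra_simps)
    then have "n * ((4 + 4 * m) * n ^ m + 4) \<le> n * ((4 + 4 * Suc m) * n ^ m)" by (intro mult_left_mono) auto
    then show "n * ((4 + 4 * m) * n ^ m + 4) \<le> (4 + 4 * Suc m) * n ^ Suc m" by (simp add: mult_ac)
  next
    fix s' assume "I n s'"
    then show "reg s' 7 = reg s 7 + a * ext_count {1..n} E (reg s ` set ys) (Suc m) \<and>
      reg s' 8 = reg s 8 + b * n ^ Suc m \<and> arr s' = arr s \<and>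
      (\<forall>r. r \<notin> {6, 7, 8} \<union> {12..<12 + Suc m} \<longrightarrow> reg s' r = reg s r)"
      by (auto simp: I_def frame_def)
  qed
qed

section \<open>The codegree test and the main loop\<close>

definition codeg_low :: "nat \<Rightarrow> nat set set \<Rightarrow> nat \<Rightarrow> nat \<Rightarrow> nat \<Rightarrow> nat \<Rightarrow> nat \<Rightarrow> bool" where
  "codeg_low n E m a b u v \<longleftrightarrow> a * ext_count {1..n} E {u, v} m < b * n ^ m"

definition test_prog :: "nat \<Rightarrow> nat \<Rightarrow> nat \<Rightarrow> prog \<Rightarrow> prog" where
  "test_prog m x y p =
     Seq (Const 7 0) (Seq (Const 8 0) (Seq (count_prog [x, y] m) (IfLess 7 8 p (Copy 6 6))))"

text \<open>The branch \<open>p\<close> enters in continuation style, so tests can be nested. The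
  cost is two resets, the count, the comparison and \<open>Suc T\<close> for the branch, which
  leaves room for the no-op on the other side.\<close>

lemma runs_test_prog:
  assumes "0 < n" "n \<le> W" "reg s 0 = n" "reg s 1 = 1" "reg s 2 = 0" "reg s 3 = a" "reg s 4 = b"
    and "{x, y} \<inter> ({6, 7, 8} \<union> {12..<12 + m}) = {}"
    and W: "a * n ^ m \<le> W" "b * n ^ m \<le> W"
    and low: "\<And>s'. \<lbrakk>codeg_low n E m a b (reg s x) (reg s y); arr s' = arr s;
        \<And>r. r \<notin> {6, 7, 8} \<union> {12..<12 + m} \<Longrightarrow> reg s' r = reg s r\<rbrakk> \<Longrightarrow> runs W E p s' (Suc T) Q"
    and high: "\<And>s'. \<lbrakk>\<not> codeg_low n E m a b (reg s x) (reg s y); arr s' = arr s;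
        \<And>r. r \<notin> {6, 7, 8} \<union> {12..<12 + m} \<Longrightarrow> reg s' r = reg s r\<rbrakk> \<Longrightarrow> Q s'"
  shows "runs W E (test_prog m x y p) s ((4 + 4 * m) * n ^ m + T + 4) Q"
proof -
  let ?T = "(4 + 4 * m) * n ^ m"
  let ?s = "set_reg 8 0 (set_reg 7 0 s)"
  have img: "reg ?s ` set [x, y] = {reg s x, reg s y}" using assms(8) by auto
  have "runs W E (count_prog [x, y] m) ?s ?T (\<lambda>s'.
     reg s' 7 = reg ?s 7 + a * ext_count {1..n} E (reg ?s ` set [x, y]) m \<and>
     reg s' 8 = reg ?s 8 + b * n ^ m \<and> arr s' = arr ?s \<and>
     (\<forall>r. r \<notin> {6, 7, 8} \<union> {12..<12 + m} \<longrightarrow> reg s' r = reg ?s r))"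
    by (rule runs_count_prog) (use assms(1-8) W in auto)
  then have "runs W E (count_prog [x, y] m) ?s ?T (\<lambda>s'.
      runs W E (IfLess 7 8 p (Copy 6 6)) s' (Suc (Suc T)) Q)"
  proof (rule runs_mono)
    fix s' :: state assume H: "reg s' 7 = reg ?s 7 + a * ext_count {1..n} E (reg ?s ` set [x, y]) m \<and>
      reg s' 8 = reg ?s 8 + b * n ^ m \<and> arr s' = arr ?s \<and>
      (\<forall>r. r \<notin> {6, 7, 8} \<union> {12..<12 + m} \<longrightarrow> reg s' r = reg ?s r)"
    then have cmp: "reg s' 7 < reg s' 8 \<longleftrightarrow> codeg_low n E m a b (reg s x) (reg s y)"
      unfolding img by (simp add: codeg_low_def)
    have arr: "arr s' = arr s" using H by simp
    have fr: "reg s' r = reg s r" if "r \<notin> {6, 7, 8} \<union> {12..<12 + m}" for r using H that by auto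
    show "runs W E (IfLess 7 8 p (Copy 6 6)) s' (Suc (Suc T)) Q"
    proof (rule runs_IfLess)
      assume "reg s' 7 < reg s' 8"
      with cmp arr fr show "runs W E p s' (Suc T) Q" by (intro low) auto
    next
      assume "\<not> reg s' 7 < reg s' 8"
      with cmp arr fr show "runs W E (Copy 6 6) s' (Suc T) Q" by (intro runs_Copy high) auto
    qed
  qed simp
  then show ?thesis unfolding test_prog_def
    apply -
    apply (rule runs_Seq[where ?T1.0 = "Suc 0" and ?T2.0 = "?T + T + 3"], rule runs_Const, simp)
     apply (rule runs_Seq[where ?T1.0 = "Suc 0" and ?T2.0 = "?T + T + 2"], rule runs_Const, simp)
      apply (rule runs_Seq[where ?T1.0 = ?T and ?T2.0 = "Suc (Suc T)"], assumption)
      apply simp_all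
    done
qed

definition common_low :: "nat \<Rightarrow> nat set set \<Rightarrow> nat \<Rightarrow> nat \<Rightarrow> nat \<Rightarrow> nat \<Rightarrow> nat set" where
  "common_low n E m a b u = {v \<in> {1..n}. codeg_low n E m a b u v \<and> codeg_low n E m a b 1 v}"

text \<open>Register 1 serves as the reference vertex 1 and as the mark stored for its class;
  vertices never stored keep the initial array value 0. Adding \<open>c\<close> for each common
  vertex replaces a multiplication before the comparison with \<open>n\<close>.\<close>

definition bipartition_prog :: "nat \<Rightarrow> nat \<Rightarrow> nat \<Rightarrow> nat \<Rightarrow> prog" where
  "bipartition_prog m a b c =
     Seq (Const 1 1) (Seq (Const 3 a) (Seq (Const 4 b) (Seq (Const 5 c)
       (For 10 (Seq (Const 9 0) (Seq
          (For 11 (test_prog m 10 11 (test_prog m 1 11 (Add 9 9 5))))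
          (IfLess 0 9 (Store 0 10 1) (Copy 6 6))))))))"

lemma runs_common_count:
  fixes n m :: nat
  assumes "0 < n" "n \<le> W" "reg s 0 = n" "reg s 1 = 1" "reg s 2 = 0" "reg s 3 = a" "reg s 4 = b"
    "reg s 5 = c" "reg s 9 = 0"
    and W: "a * n ^ m \<le> W" "b * n ^ m \<le> W" "c * n \<le> W"
  defines "u \<equiv> reg s 10"
  shows "runs W E (For 11 (test_prog m 10 11 (test_prog m 1 11 (Add 9 9 5)))) s
    (n * (2 * ((4 + 4 * m) * n ^ m) + 11))
    (\<lambda>s'. reg s' 9 = c * card (common_low n E m a b u) \<and> arr s' = arr s \<and>
       (\<forall>r\<in>{0, 1, 2, 3, 4, 5, 10}. reg s' r = reg s r))"
proof -
  let ?F = "{0, 1, 2, 3, 4, 5, 10} :: nat set"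
  let ?P = "\<lambda>v. codeg_low n E m a b u v \<and> codeg_low n E m a b 1 v"
  let ?T = "(4 + 4 * m) * n ^ m"
  define I where "I j s' \<longleftrightarrow> reg s' 9 = c * card {v \<in> {1..j}. ?P v} \<and> arr s' = arr s \<and>
     (\<forall>r\<in>?F. reg s' r = reg s r)" for j and s' :: state
  have step_card: "card {v \<in> {1..Suc j}. ?P v} = card {v \<in> {1..j}. ?P v} + of_bool (?P (Suc j))" for j
  proof (cases "?P (Suc j)")
    case True
    then have "{v \<in> {1..Suc j}. ?P v} = insert (Suc j) {v \<in> {1..j}. ?P v}" by (auto simp: le_Suc_eq)
    then show ?thesis using True by simp
  next
    case False
    then have "{v \<in> {1..Suc j}. ?P v} = {v \<in> {1..j}. ?P v}" by (auto simp: le_Suc_eq)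
    then show ?thesis using False by simp
  qed
  have "runs W E (For 11 (test_prog m 10 11 (test_prog m 1 11 (Add 9 9 5)))) s
    (n * ((?T + (?T + 3) + 4) + 4)) (I n)"
  proof (rule runs_For)
    show "reg s' 0 = n \<and> reg s' 1 = 1" if "I j s'" for j s'
      using that assms by (auto simp: I_def)
    show "I 0 (set_reg 11 0 s)" using assms by (auto simp: I_def)
    fix j s' assume j: "j < n" and I: "I j s'"
    let ?Q = "\<lambda>s'. I (Suc j) s' \<and> reg s' 11 = Suc j"
    let ?s = "set_reg 11 (Suc j) s'"
    have rs: "\<And>r. r \<in> ?F \<Longrightarrow> reg ?s r = reg s r" using I by (auto simp: I_def)
    have rs': "reg ?s 0 = n" "reg ?s 1 = 1" "reg ?s 2 = 0" "reg ?s 3 = a" "reg ?s 4 = b"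
      using rs[of 0] rs[of 1] rs[of 2] rs[of 3] rs[of 4] assms(3-7) by simp_all
    \<comment> \<open>Failure of either test leaves the count unchanged, so both negative branches
      end here.\<close>
    have skip: "?Q s2" if s2: "arr s2 = arr s'" "\<not> ?P (Suc j)"
      "\<And>r. r \<notin> {6, 7, 8} \<union> {12..<12 + m} \<Longrightarrow> reg s2 r = reg ?s r" for s2
    proof -
      have "reg s2 9 = reg s' 9" "reg s2 11 = Suc j" "\<forall>r\<in>?F. reg s2 r = reg s' r"
        using s2(3) by auto
      then show ?thesis using I s2(1,2) step_card[of j] by (auto simp: I_def)
    qed
    have "runs W E (test_prog m 10 11 (test_prog m 1 11 (Add 9 9 5))) ?s (?T + (?T + 3) + 4) ?Q"
    proof (rule runs_test_prog)
      fix s1 :: state assume low1: "codeg_low n E m a b (reg ?s 10) (reg ?s 11)" and arr1: "arr s1 = arr ?s"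
        and fr1: "\<And>r. r \<notin> {6, 7, 8} \<union> {12..<12 + m} \<Longrightarrow> reg s1 r = reg ?s r"
      have r1: "reg s1 r = reg s r" if "r \<in> ?F" for r
      proof -
        have "reg s1 r = reg ?s r" using that by (intro fr1) auto
        then show ?thesis using rs[OF that] by simp
      qed
      have r1': "reg s1 11 = Suc j" using fr1[of 11] by simp
      have "runs W E (test_prog m 1 11 (Add 9 9 5)) s1 (?T + 0 + 4) ?Q"
      proof (rule runs_test_prog)
        fix s2 :: state assume low2: "codeg_low n E m a b (reg s1 1) (reg s1 11)" and arr2: "arr s2 = arr s1"
          and fr2: "\<And>r. r \<notin> {6, 7, 8} \<union> {12..<12 + m} \<Longrightarrow> reg s2 r = reg s1 r"
        have r2: "reg s2 9 = reg s' 9" "reg s2 5 = c" "reg s2 11 = Suc j" "\<forall>r\<in>?F. reg s2 r = reg s r"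
          using fr1[of 9] r1[of 5] assms(8) r1' r1 by (auto simp: fr2)
        have P: "?P (Suc j)" using low1 low2 r1[of 1] r1' rs[of 10] assms(4) by (simp add: u_def)
        have new: "reg s2 9 + reg s2 5 = c * card {v \<in> {1..Suc j}. ?P v}"
          using I P step_card[of j] by (simp add: I_def r2)
        have "card {v \<in> {1..Suc j}. ?P v} \<le> card {1..Suc j}" by (intro card_mono) auto
        then have "card {v \<in> {1..Suc j}. ?P v} \<le> n" using j by simp
        then have "c * card {v \<in> {1..Suc j}. ?P v} \<le> W" using W(3) by (meson mult_le_mono2 order_trans)
        with new have "reg s2 9 + reg s2 5 \<le> W" by simp
        moreover have "?Q (set_reg 9 (reg s2 9 + reg s2 5) s2)"
          using new r2 arr1 arr2 I by (auto simp: I_def)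
        ultimately show "runs W E (Add 9 9 5) s2 (Suc 0) ?Q" by (rule runs_Add)
      next
        fix s2 :: state assume "\<not> codeg_low n E m a b (reg s1 1) (reg s1 11)" "arr s2 = arr s1"
          "\<And>r. r \<notin> {6, 7, 8} \<union> {12..<12 + m} \<Longrightarrow> reg s2 r = reg s1 r"
        then show "?Q s2" using arr1 fr1 r1[of 1] r1' assms(4) by (intro skip) auto
      qed (use assms r1 r1' in auto)
      then show "runs W E (test_prog m 1 11 (Add 9 9 5)) s1 (Suc (?T + 3)) ?Q" by (simp add: numeral_eq_Suc)
    next
      fix s1 :: state assume "\<not> codeg_low n E m a b (reg ?s 10) (reg ?s 11)" "arr s1 = arr ?s"
        "\<And>r. r \<notin> {6, 7, 8} \<union> {12..<12 + m} \<Longrightarrow> reg s1 r = reg ?s r"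
      then show "?Q s1" using rs[of 10] by (intro skip) (auto simp: u_def)
    qed (use assms(1,2) W rs' in simp_all)
    then show "runs W E (test_prog m 10 11 (test_prog m 1 11 (Add 9 9 5))) ?s (?T + (?T + 3) + 4) ?Q" .
  qed (use assms in auto)
  then show ?thesis
    by (rule runs_mono) (auto simp: I_def common_low_def)
qed

lemma runs_bipartition_prog:
  fixes n m :: nat
  assumes n: "0 < n" "n \<le> W"
    and W: "a * n ^ m \<le> W" "b * n ^ m \<le> W" "c * n \<le> W"
  shows "runs W E (bipartition_prog m a b c) (init_state n) ((8 * m + 30) * n ^ (m + 2))
    (\<lambda>s. \<forall>v\<in>{1..n}. arr s 0 v = of_bool (n < c * card (common_low n E m a b v)))"
proof -
  let ?F = "{1, 2, 3, 4, 5} :: nat set"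
  let ?N = "(8 * m + 8) * n ^ m"
  define regs where "regs s \<longleftrightarrow> reg s 0 = n \<and> reg s 1 = 1 \<and> reg s 2 = 0 \<and> reg s 3 = a \<and> reg s 4 = b \<and> reg s 5 = c" for s :: state
  define f where "f v = (of_bool (n < c * card (common_low n E m a b v)) :: nat)" for v
  \<comment> \<open>Entries not yet processed are still the initial 0, so a failed comparison needs
    no store.\<close>
  define I where "I j s \<longleftrightarrow> regs s \<and> (\<forall>v. arr s 0 v = (if v \<in> {1..j} then f v else 0))" for j s
  have small: "1 \<le> W" "a \<le> W" "b \<le> W" "c \<le> W"
    using n W by (auto intro: order_trans[OF _ W(1)] order_trans[OF _ W(2)] order_trans[OF _ W(3)])
  let ?body = "Seq (Const 9 0) (Seq (For 11 (test_prog m 10 11 (test_prog m 1 11 (Add 9 9 5))))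
          (IfLess 0 9 (Store 0 10 1) (Copy 6 6)))"
  have For: "runs W E (For 10 ?body) s (n * (n * (?N + 11) + 3 + 4)) (I n)" if s: "regs s" "arr s = (\<lambda>_ _. 0)" for s
  proof (rule runs_For)
    show "reg s' 0 = n \<and> reg s' 1 = 1" if "I j s'" for j s'
      using that by (auto simp: I_def regs_def)
    show "I 0 (set_reg 10 0 s)" using s by (auto simp: I_def regs_def)
    fix j s' assume j: "j < n" and I: "I j s'"
    let ?Q = "\<lambda>s'. I (Suc j) s' \<and> reg s' 10 = Suc j"
    let ?s = "set_reg 9 0 (set_reg 10 (Suc j) s')"
    have rs: "regs ?s" using I by (auto simp: I_def regs_def)
    have "runs W E (For 11 (test_prog m 10 11 (test_prog m 1 11 (Add 9 9 5)))) ?s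
       (n * (2 * ((4 + 4 * m) * n ^ m) + 11))
      (\<lambda>s1. reg s1 9 = c * card (common_low n E m a b (reg ?s 10)) \<and> arr s1 = arr ?s \<and>
       (\<forall>r\<in>{0, 1, 2, 3, 4, 5, 10}. reg s1 r = reg ?s r))"
      by (rule runs_common_count) (use n W rs in \<open>auto simp: regs_def\<close>)
    then have "runs W E (For 11 (test_prog m 10 11 (test_prog m 1 11 (Add 9 9 5)))) ?s
       (n * (?N + 11)) (\<lambda>s1. runs W E (IfLess 0 9 (Store 0 10 1) (Copy 6 6)) s1 (Suc (Suc 0)) ?Q)"
    proof (rule runs_mono)
      fix s1 :: state assume H: "reg s1 9 = c * card (common_low n E m a b (reg ?s 10)) \<and> arr s1 = arr ?s \<and>
       (\<forall>r\<in>{0, 1, 2, 3, 4, 5, 10}. reg s1 r = reg ?s r)"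
      then have r1: "regs s1" "reg s1 10 = Suc j" "arr s1 = arr s'" using rs by (auto simp: regs_def)
      have f: "f (Suc j) = of_bool (n < reg s1 9)" using H by (simp add: f_def)
      show "runs W E (IfLess 0 9 (Store 0 10 1) (Copy 6 6)) s1 (Suc (Suc 0)) ?Q"
        using I r1 f by (intro runs_IfLess runs_Store runs_Copy) (auto simp: I_def regs_def le_Suc_eq)
    qed (simp add: algebra_simps)
    then show "runs W E ?body (set_reg 10 (Suc j) s') (n * (?N + 11) + 3) ?Q"
      by (intro runs_Seq[where ?T1.0 = "Suc 0" and ?T2.0 = "n * (?N + 11) + 2"] runs_Const
          runs_Seq[where ?T1.0 = "n * (?N + 11)" and ?T2.0 = "Suc (Suc 0)"]) auto
  qed (use n in auto)
  have "1 \<le> n ^ m" using n by simp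
  then have time: "n * (n * (?N + 11) + 3 + 4) + 4 \<le> (8 * m + 30) * n ^ (m + 2)"
  proof -
    have le: "n \<le> n ^ (m + 2)" "n * n \<le> n ^ (m + 2)" "1 \<le> n ^ (m + 2)"
      using n \<open>1 \<le> n ^ m\<close> by (auto simp: power_add power2_eq_square)
    \<comment> \<open>All lower-order terms are at most multiples of \<open>n ^ (m + 2)\<close>, and
      8 + 11 + 7 + 4 = 30.\<close>
    have "n * (n * (?N + 11) + 3 + 4) + 4 = (8 * m + 8) * n ^ (m + 2) + 11 * (n * n) + 7 * n + 4"
      by (simp add: algebra_simps power_add power2_eq_square)
    also have "\<dots> \<le> (8 * m + 8) * n ^ (m + 2) + 11 * n ^ (m + 2) + 7 * n ^ (m + 2) + 4 * n ^ (m + 2)"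
      using le by (intro add_mono mult_left_mono) auto
    finally show ?thesis by (simp add: algebra_simps)
  qed
  let ?s = "set_reg 5 c (set_reg 4 b (set_reg 3 a (set_reg 1 1 (init_state n))))"
  let ?T = "n * (n * (?N + 11) + 3 + 4)"
  have "regs ?s" "arr ?s = (\<lambda>_ _. 0)" by (auto simp: regs_def init_state_def)
  from For[OF this] have "runs W E (For 10 ?body) ?s ?T
      (\<lambda>s. \<forall>v\<in>{1..n}. arr s 0 v = of_bool (n < c * card (common_low n E m a b v)))"
    by (rule runs_mono) (auto simp: I_def f_def)
  then have "runs W E (bipartition_prog m a b c) (init_state n) (?T + 4)
      (\<lambda>s. \<forall>v\<in>{1..n}. arr s 0 v = of_bool (n < c * card (common_low n E m a b v)))"
    unfolding bipartition_prog_def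
    apply -
    apply (rule runs_Seq[where ?T1.0 = "Suc 0" and ?T2.0 = "?T + 3"], rule runs_Const, rule small)
     apply (rule runs_Seq[where ?T1.0 = "Suc 0" and ?T2.0 = "?T + 2"], rule runs_Const, rule small)
      apply (rule runs_Seq[where ?T1.0 = "Suc 0" and ?T2.0 = "?T + 1"], rule runs_Const, rule small)
       apply (rule runs_Seq[where ?T1.0 = "Suc 0" and ?T2.0 = "?T"], rule runs_Const, rule small)
        apply assumption
       apply simp_all
    done
  then show ?thesis by (rule runs_mono) (use time in auto)
qed

section \<open>The union bound\<close>

lemma bipartition_iff:
  assumes V: "verts H = V" and H: "uniform_hypergraph k H"
  shows "bipartition H X Y \<longleftrightarrow> X \<subseteq> V \<and> Y = V - X \<and> edges H \<subseteq> crossing V X k"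
proof -
  have E: "edges H \<subseteq> nsets V k" using V H by (simp add: uniform_hypergraph_def)
  then have sub: "e \<subseteq> V" if "e \<in> edges H" for e using that by (auto simp: nsets_def)
  have parts: "X \<union> Y = V \<and> X \<inter> Y = {} \<longleftrightarrow> X \<subseteq> V \<and> Y = V - X" by blast
  have "(\<forall>e\<in>edges H. e \<inter> X \<noteq> {} \<and> e \<inter> (V - X) \<noteq> {}) \<longleftrightarrow> edges H \<subseteq> crossing V X k"
  proof -
    have "e \<inter> (V - X) = e - X" if "e \<in> edges H" for e using sub[OF that] by blast
    then show ?thesis using E by (auto simp: crossing_def)
  qed
  then show ?thesis unfolding bipartition_def V using parts by metis
qed

lemma bipartition_commute: "bipartition H X Y \<longleftrightarrow> bipartition H Y X"
  unfolding bipartition_def by blast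

definition balanced_typical :: "nat \<Rightarrow> nat \<Rightarrow> nat set \<Rightarrow> nat set set \<Rightarrow> bool" where
  "balanced_typical k n X E \<longleftrightarrow> n \<le> 4 * k * card X \<and> n \<le> 4 * k * card ({1..n} - X) \<and>
     typical {1..n} X k (1 / (384 * real k * real ((4 * k) ^ (k - 2)))) E"

text \<open>Every bipartition must be balanced and typical, not just one: uniqueness comes from
  showing that each is determined by the edges.\<close>

definition good_graphs :: "nat \<Rightarrow> nat \<Rightarrow> nat hypergraph set" where
  "good_graphs k n = {H \<in> bipartite_graphs k n. \<forall>X Y. bipartition H X Y \<longrightarrow> balanced_typical k n X (edges H)}"

lemma two_powr_diff: "2 powr (real M - x) = 2 ^ M * 2 powr (- x)" for x :: real
  using powr_add[of 2 "real M" "- x"] by (simp add: powr_realpow)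

lemma good_graphs_bipartition_constructed:
  fixes k n :: nat
  defines "g \<equiv> (4 * k) ^ (k - 2)"
  assumes "3 \<le> k" and large: "4 * g * k\<^sup>2 \<le> n" and pos: "0 < n" and good: "H \<in> good_graphs k n"
  shows "unique_bipartition H \<and>
    constructs_bipartition (n ^ k) (bipartition_prog (k - 2) (4 * g) (2 * g - 1) (8 * k)) n H
      (real (8 * (k - 2) + 30) * real n ^ k)"
proof -
  define m where "m = k - 2"
  let ?V = "{1..n}"
  \<comment> \<open>\<open>Z\<close> depends on the edges alone, so any two bipartition classes
    containing vertex 1 coincide.\<close>
  define Z where "Z = {u \<in> ?V. n < 8 * k * card (common_low n (edges H) m (4 * g) (2 * g - 1) u)}"
  have H: "verts H = ?V" "uniform_hypergraph k H" "bipartite H"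
    using good unfolding good_graphs_def bipartite_graphs_def by blast+
  have cl: "common_low n (edges H) m (4 * g) (2 * g - 1) u =
      {v \<in> ?V. 4 * g * ext_count ?V (edges H) {u, v} m < (2 * g - 1) * n ^ m \<and>
              4 * g * ext_count ?V (edges H) {1, v} m < (2 * g - 1) * n ^ m}" for u
    by (simp add: common_low_def codeg_low_def)
  have Z: "X = Z \<and> Y = ?V - Z" if bip: "bipartition H X Y" and "1 \<in> X" for X Y
  proof -
    have XY: "X \<subseteq> ?V" "Y = ?V - X" using bip bipartition_iff[OF H(1,2)] by blast+
    have bt: "balanced_typical k n X (edges H)" using good bip unfolding good_graphs_def by blast
    have "u \<in> Z \<longleftrightarrow> u \<in> X" if u: "u \<in> ?V" for u
    proof -
      have "n < 8 * k * card (common_low n (edges H) m (4 * g) (2 * g - 1) u) \<longleftrightarrow> u \<in> X"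
        unfolding cl unfolding m_def g_def
        using mem_class_iff_common_low[of ?V X 1 u k "edges H"] XY u \<open>1 \<in> X\<close> bt large \<open>3 \<le> k\<close> pos
        unfolding balanced_typical_def g_def by (simp only: card_atLeastAtMost finite_atLeastAtMost diff_Suc_1)
      then show ?thesis using u by (simp add: Z_def)
    qed
    moreover have "Z \<subseteq> ?V" unfolding Z_def by blast
    ultimately have "X = Z" using XY(1) by blast
    then show ?thesis using XY(2) by blast
  qed
  have one: "1 \<in> X \<or> 1 \<in> Y" if "bipartition H X Y" for X Y
  proof -
    have "X \<union> Y = ?V" using that H(1) by (simp add: bipartition_def)
    moreover have "1 \<in> ?V" using pos by simp
    ultimately show ?thesis by blast
  qed
  obtain X Y where XY: "bipartition H X Y" using H(3) unfolding bipartite_def by blast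
  from one[OF this] have bipZ: "bipartition H Z (?V - Z)"
  proof
    assume "1 \<in> X"
    then show ?thesis using Z[OF XY] XY by blast
  next
    assume "1 \<in> Y"
    moreover have "bipartition H Y X" using XY bipartition_commute by blast
    ultimately show ?thesis using Z[of Y X] by blast
  qed
  have "unique_bipartition H"
    unfolding unique_bipartition_def
  proof (intro exI conjI allI impI)
    show "bipartition H Z (?V - Z)" by (rule bipZ)
    fix X' Y' assume b: "bipartition H X' Y'"
    then have "1 \<in> X' \<or> 1 \<in> Y'" by (rule one)
    moreover have "bipartition H Y' X'" using b bipartition_commute by blast
    ultimately show "X' = Z \<and> Y' = ?V - Z \<or> X' = ?V - Z \<and> Y' = Z" using Z[OF b] Z[of Y' X'] by blast
  qed
  moreover have "constructs_bipartition (n ^ k) (bipartition_prog m (4 * g) (2 * g - 1) (8 * k)) n H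
      (real (8 * m + 30) * real n ^ k)"
  proof -
    have k: "k = m + 2" using \<open>3 \<le> k\<close> by (simp add: m_def)
    have g: "1 \<le> g" using \<open>3 \<le> k\<close> by (simp add: g_def)
    \<comment> \<open>The constants of the program are at most \<open>n\<close>, so all accumulated
      values fit into words of size \<open>n ^ k\<close>.\<close>
    have "4 * g * 1 \<le> 4 * g * k\<^sup>2" using \<open>3 \<le> k\<close> by (intro mult_left_mono) auto
    then have gn: "4 * g \<le> n" using large by linarith
    have "8 * k \<le> 4 * k\<^sup>2" using \<open>3 \<le> k\<close> by (simp add: power2_eq_square)
    also have "\<dots> \<le> 4 * g * k\<^sup>2" using g by simp
    finally have kn: "8 * k \<le> n" using large by linarith
    have nk: "n ^ k = n * n ^ (m + 1)" "n ^ (m + 1) = n * n ^ m" using k by simp_all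
    have n1: "1 \<le> n ^ m" using pos by simp
    have mono: "n ^ m \<le> n ^ (m + 1)" "n \<le> n ^ (m + 1)" "n \<le> n ^ k"
      using pos n1 by (simp_all add: k)
    have "runs (n ^ k) (edges H) (bipartition_prog m (4 * g) (2 * g - 1) (8 * k)) (init_state n)
      ((8 * m + 30) * n ^ (m + 2))
      (\<lambda>s. \<forall>v\<in>{1..n}. arr s 0 v =
         of_bool (n < 8 * k * card (common_low n (edges H) m (4 * g) (2 * g - 1) v)))"
    proof (rule runs_bipartition_prog)
      show "4 * g * n ^ m \<le> n ^ k" unfolding nk(1) using gn mono by (intro mult_mono) auto
      show "(2 * g - 1) * n ^ m \<le> n ^ k" unfolding nk(1) using gn mono by (intro mult_mono) auto
      show "8 * k * n \<le> n ^ k" unfolding nk(1) using kn mono by (intro mult_mono) auto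
    qed (rule pos mono)+
    then obtain t s where ts: "exec (n ^ k) (edges H) (bipartition_prog m (4 * g) (2 * g - 1) (8 * k)) (init_state n) t s"
      "t \<le> (8 * m + 30) * n ^ k"
      and arr: "\<forall>v\<in>{1..n}. arr s 0 v =
         of_bool (n < 8 * k * card (common_low n (edges H) m (4 * g) (2 * g - 1) v))"
      unfolding runs_def k[symmetric] by blast
    have out: "output_class n 1 s = Z" "output_class n 0 s = ?V - Z"
      using arr by (auto simp: output_class_def Z_def of_bool_def split: if_splits)
    have "bipartition H (output_class n 1 s) (output_class n 0 s)"
      unfolding out by (rule bipZ)
    moreover have "real t \<le> real (8 * m + 30) * real n ^ k"
      using ts(2) by (metis of_nat_le_iff of_nat_mult of_nat_power)
    ultimately show ?thesis unfolding constructs_bipartition_def using ts(1) by blast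
  qed
  ultimately show ?thesis unfolding m_def by (rule conjI)
qed

section \<open>Counting the exceptional hypergraphs\<close>

lemma card_not_balanced_typical_le:
  fixes k n M :: nat and d :: real
  defines "d \<equiv> 1 / (384 * real k * real ((4 * k) ^ (k - 2)))"
  assumes "3 \<le> k" "X \<subseteq> {1..n}" and M: "card (crossing {1..n} X k) \<le> M" "3 * (n choose k) \<le> 4 * M"
  shows "real (card {E \<in> Pow (crossing {1..n} X k). \<not> balanced_typical k n X E})
    \<le> 2 powr (real M - real (n choose k) / 2) +
       2 ^ M * (2 * real n * 2 ^ n * exp (- (2 * d\<^sup>2 / real k ^ (k - 1) * real n ^ (k - 1))))"
    (is "_ \<le> ?A + ?B")
proof -
  let ?V = "{1..n}"
  let ?K = "crossing ?V X k"
  have fin: "finite ?K" by (simp add: finite_crossing)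
  have AB: "?A \<ge> 0" "?B \<ge> 0" by simp_all
  show ?thesis
  proof (cases "n \<le> 4 * k * card X \<and> n \<le> 4 * k * card (?V - X)")
    case True
    then have "{E \<in> Pow ?K. \<not> balanced_typical k n X E} = {E \<in> Pow ?K. \<not> typical ?V X k d E}"
      by (auto simp: balanced_typical_def d_def)
    also have "real (card \<dots>) \<le> 2 ^ card ?K *
        (2 * real n * 2 ^ n * exp (- (2 * d\<^sup>2 / real k ^ (k - 1) * real n ^ (k - 1))))"
      using card_not_typical_le[of ?V k d X] assms by (simp add: d_def)
    also have "\<dots> \<le> ?B" using M by (intro mult_right_mono power_increasing) auto
    finally show ?thesis using AB by linarith
  next
    case False
    have "4 * card ?K \<le> n choose k"
    proof (cases "n \<le> 4 * k * card X")
      case True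
      then show ?thesis using False assms card_crossing_le[of ?V "?V - X" k] by (simp add: crossing_Diff)
    next
      case False
      then show ?thesis using assms card_crossing_le[of ?V X k] by simp
    qed
    \<comment> \<open>One quarter of the \<open>k\<close>-sets is three quarters minus a half, and
      \<open>M\<close> is at least three quarters.\<close>
    then have K: "real (card ?K) \<le> real M - real (n choose k) / 2" using M(2) by linarith
    have "real (card {E \<in> Pow ?K. \<not> balanced_typical k n X E}) \<le> real (card (Pow ?K))"
      using fin by (intro of_nat_mono card_mono) auto
    also have "\<dots> = 2 powr real (card ?K)" using fin by (simp add: card_Pow powr_realpow)
    also have "\<dots> \<le> ?A" using K by simp
    finally show ?thesis using AB by linarith
  qed
qed

text \<open>All \<open>2 ^ M\<close> subsets of a largest crossing set are bipartite, so
  \<open>2 ^ M\<close> bounds the whole class from below. Every exceptional hypergraph is bad for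
  one of the \<open>2 ^ n\<close> sets \<open>X\<close>, and each \<open>X\<close> contributes a
  small multiple of \<open>2 ^ M\<close>.\<close>

lemma card_not_good_graphs_le:
  fixes k n :: nat and d :: real
  defines "d \<equiv> 1 / (384 * real k * real ((4 * k) ^ (k - 2)))"
  assumes "3 \<le> k"
  shows "real (card (bipartite_graphs k n - good_graphs k n)) \<le> real (card (bipartite_graphs k n)) *
    (2 ^ n * (2 powr (- (real (n choose k) / 2)) +
       2 * real n * 2 ^ n * exp (- (2 * d\<^sup>2 / real k ^ (k - 1) * real n ^ (k - 1)))))"
proof -
  let ?V = "{1..n}"
  let ?bad = "\<lambda>X. {E \<in> Pow (crossing ?V X k). \<not> balanced_typical k n X E}"
  let ?e = "2 * real n * 2 ^ n * exp (- (2 * d\<^sup>2 / real k ^ (k - 1) * real n ^ (k - 1)))"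
  define M where "M = Max ((\<lambda>X. card (crossing ?V X k)) ` Pow ?V)"
  have M: "card (crossing ?V X k) \<le> M" if "X \<subseteq> ?V" for X
    unfolding M_def using that by (intro Max_ge) auto
  have "M \<in> (\<lambda>X. card (crossing ?V X k)) ` Pow ?V"
    unfolding M_def by (intro Max_in) auto
  then obtain X0 where X0: "X0 \<subseteq> ?V" "card (crossing ?V X0 k) = M" by auto
  obtain X1 where "X1 \<subseteq> ?V" "3 * (n choose k) \<le> 4 * card (crossing ?V X1 k)"
    using ex_card_crossing_ge[of ?V k] assms by auto
  then have M34: "3 * (n choose k) \<le> 4 * M" using M[of X1] by linarith
  have fin: "finite (crossing ?V X k)" for X by (simp add: finite_crossing)
  have "Pair ?V ` Pow (crossing ?V X0 k) \<subseteq> bipartite_graphs k n"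
  proof
    fix H assume "H \<in> Pair ?V ` Pow (crossing ?V X0 k)"
    then have H: "verts H = ?V" "edges H \<subseteq> crossing ?V X0 k" by auto
    then have u: "uniform_hypergraph k H" by (auto simp: uniform_hypergraph_def crossing_def)
    then have "bipartition H X0 (?V - X0)" using H X0 bipartition_iff[OF H(1) u] by simp
    then show "H \<in> bipartite_graphs k n" using H u by (auto simp: bipartite_graphs_def bipartite_def)
  qed
  then have "card (Pair ?V ` Pow (crossing ?V X0 k)) \<le> card (bipartite_graphs k n)"
    by (intro card_mono finite_bipartite_graphs)
  then have "2 ^ M \<le> card (bipartite_graphs k n)"
    using fin X0 by (simp add: card_image card_Pow inj_on_def)
  then have B: "2 ^ M \<le> real (card (bipartite_graphs k n))"
    by (metis of_nat_le_iff of_nat_numeral of_nat_power)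
  have "bipartite_graphs k n - good_graphs k n \<subseteq> (\<Union>X\<in>Pow ?V. Pair ?V ` ?bad X)"
  proof
    fix H assume H: "H \<in> bipartite_graphs k n - good_graphs k n"
    then have HV: "verts H = ?V" "uniform_hypergraph k H" by (auto simp: bipartite_graphs_def)
    obtain X Y where XY: "bipartition H X Y" "\<not> balanced_typical k n X (edges H)"
      using H by (auto simp: good_graphs_def)
    then have "X \<in> Pow ?V" "edges H \<in> ?bad X" using bipartition_iff[OF HV] by auto
    moreover have "H = (?V, edges H)" using HV by (metis prod.collapse)
    ultimately show "H \<in> (\<Union>X\<in>Pow ?V. Pair ?V ` ?bad X)" by blast
  qed
  then have "card (bipartite_graphs k n - good_graphs k n) \<le> card (\<Union>X\<in>Pow ?V. Pair ?V ` ?bad X)"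
    using fin by (intro card_mono) auto
  also have "\<dots> \<le> (\<Sum>X\<in>Pow ?V. card (Pair ?V ` ?bad X))" by (rule card_UN_le) simp
  also have "\<dots> = (\<Sum>X\<in>Pow ?V. card (?bad X))"
    by (intro sum.cong refl card_image) (auto simp: inj_on_def)
  finally have "real (card (bipartite_graphs k n - good_graphs k n)) \<le> (\<Sum>X\<in>Pow ?V. real (card (?bad X)))"
    by (simp flip: of_nat_sum)
  also have "\<dots> \<le> (\<Sum>X\<in>Pow ?V. 2 powr (real M - real (n choose k) / 2) + 2 ^ M * ?e)"
    unfolding d_def using assms(2) M M34 by (intro sum_mono card_not_balanced_typical_le) auto
  also have "\<dots> = 2 ^ n * (2 powr (real M - real (n choose k) / 2) + 2 ^ M * ?e)"
    by (simp add: card_Pow)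
  also have "2 powr (real M - real (n choose k) / 2) = 2 ^ M * 2 powr (- (real (n choose k) / 2))"
    by (rule two_powr_diff)
  also have "2 ^ n * (2 ^ M * 2 powr (- (real (n choose k) / 2)) + 2 ^ M * ?e) =
      2 ^ M * (2 ^ n * (2 powr (- (real (n choose k) / 2)) + ?e))"
    by (simp only: distrib_left mult.left_commute)
  also have "\<dots> \<le> real (card (bipartite_graphs k n)) * (2 ^ n * (2 powr (- (real (n choose k) / 2)) + ?e))"
    using B by (intro mult_right_mono) auto
  finally show ?thesis .
qed

text \<open>\<open>3 \<le> k\<close> enters through \<open>n * n \<le> N\<close>: the exponent
  \<open>c * N\<close> then dominates the linear exponents from the union bounds. Each of the two
  terms is brought below half of the target.\<close>

lemma union_bound_le:
  fixes k n :: nat and c :: real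
  assumes k: "3 \<le> k" "k \<le> n" and c: "0 < c" and n: "5 / c \<le> real n" "2 * real k ^ k * (2 + c) \<le> real n"
  shows "2 ^ n * (2 powr (- (real (n choose k) / 2)) + 2 * real n * 2 ^ n * exp (- (2 * c * real n ^ (k - 1))))
    \<le> 1 / 2 powr (c * real n ^ (k - 1))"
proof -
  define N where "N = real n ^ (k - 1)"
  have n1: "1 \<le> real n" "0 < k" using k by auto
  have "real n ^ 2 \<le> N" unfolding N_def using k by (intro power_increasing) auto
  then have nN: "real n * real n \<le> N" by (simp add: power2_eq_square)
  have n_le_N: "real n \<le> N" using nN n1 mult_left_mono[of 1 "real n" "real n"] by linarith
  have nk: "real n ^ k = real n * N" using n1 by (cases k) (auto simp: N_def)
  have "real n ^ k / real k ^ k \<le> real (n choose k)"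
    using binomial_ge_n_over_k_pow_k[OF k(2), where 'a = real] by (simp add: power_divide)
  then have 1: "real n * N / real k ^ k \<le> real (n choose k)" unfolding nk .
  have "2 * real k ^ k * (2 + c) * N \<le> real n * N" using n n_le_N n1 by (intro mult_right_mono) auto
  then have "2 * (2 + c) * N \<le> real n * N / real k ^ k" using n1 by (simp add: field_simps)
  with 1 have "2 * (2 + c) * N \<le> real (n choose k)" by (rule order_trans[rotated])
  then have "2 * N + c * N \<le> real (n choose k) / 2" by (simp add: distrib_left distrib_right)
  \<comment> \<open>Of the surplus \<open>2 * N\<close>, one \<open>N\<close> pays for
    \<open>n\<close> and the other for 1.\<close>
  then have e1: "real n - real (n choose k) / 2 \<le> - 1 - c * N"
    using n_le_N n1 by linarith
  have "2 ^ n * 2 powr (- (real (n choose k) / 2)) = 2 powr (real n - real (n choose k) / 2)"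
    by (rule two_powr_diff[symmetric])
  also have "\<dots> \<le> 2 powr (- 1 - c * N)" using e1 by simp
  finally have A: "2 ^ n * 2 powr (- (real (n choose k) / 2)) \<le> 2 powr (- 1 - c * N)" .
  have "5 \<le> c * real n" using n(1) c by (simp add: field_simps)
  then have "5 * real n \<le> c * real n * real n" using n1 by (intro mult_right_mono) auto
  also have "\<dots> \<le> c * N" using mult_left_mono[OF nN, of c] c by (simp add: mult_ac)
  finally have cN: "5 * real n \<le> c * N" .
  have "real n \<le> 2 ^ n" using of_nat_less_two_power[of n, where 'a = real] by simp
  then have n2: "2 * real n \<le> 2 powr (1 + real n)" by (simp add: powr_add powr_realpow)
  have "exp (- (2 * c * N)) \<le> 2 powr (- (2 * c * N))"
  proof -
    have "ln 2 \<le> (1::real)" using ln_le_minus_one[of 2] by simp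
    moreover have "0 \<le> 2 * c * N" using c n_le_N n1 by simp
    ultimately have "2 * c * N * ln 2 \<le> 2 * c * N" using mult_left_mono[of "ln 2" 1 "2 * c * N"] by simp
    then show ?thesis by (simp add: powr_def)
  qed
  then have "2 * real n * 2 ^ n * exp (- (2 * c * N)) \<le> 2 powr (1 + real n) * 2 ^ n * 2 powr (- (2 * c * N))"
    using n2 by (intro mult_mono) auto
  then have "2 ^ n * (2 * real n * 2 ^ n * exp (- (2 * c * N)))
      \<le> 2 ^ n * (2 powr (1 + real n) * 2 ^ n * 2 powr (- (2 * c * N)))" by simp
  also have "\<dots> = 2 powr (real n + (1 + real n + real n + - (2 * c * N)))"
    by (simp only: powr_add powr_realpow[OF zero_less_numeral])
  \<comment> \<open>The exponent is \<open>3 * n + 1 - 2 * c * N\<close>, and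
    \<open>5 * n \<le> c * N\<close> with \<open>1 \<le> n\<close> absorbs the linear part and one
    extra 1.\<close>
  also have "\<dots> \<le> 2 powr (- 1 - c * N)"
    using cN n1 by (intro powr_mono) linarith+
  finally have "2 ^ n * (2 * real n * 2 ^ n * exp (- (2 * c * N))) \<le> 2 powr (- 1 - c * N)" .
  with A have "2 ^ n * (2 powr (- (real (n choose k) / 2)) + 2 * real n * 2 ^ n * exp (- (2 * c * N)))
      \<le> 2 * 2 powr (- 1 - c * N)" by (simp add: distrib_left)
  also have "\<dots> = 1 / 2 powr (c * N)" by (simp add: powr_diff powr_minus)
  finally show ?thesis by (simp add: N_def)
qed

theorem mainTheorem2:
  fixes k :: nat
  assumes "k \<ge> 3"
  shows "\<exists>(c::real) (C::real) (n0::nat) (d::nat) (p::prog). c > 0 \<and> C > 0 \<and>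
    (\<forall>n\<ge>n0. \<exists>G \<subseteq> bipartite_graphs k n.
       real (card (bipartite_graphs k n - G))
         \<le> real (card (bipartite_graphs k n)) / 2 powr (c * real n ^ (k - 1)) \<and>
       (\<forall>H\<in>G. unique_bipartition H \<and>
          constructs_bipartition (n ^ d) p n H (C * real n ^ k)))"
proof -
  define g where "g = (4 * k) ^ (k - 2)"
  define \<delta> where "\<delta> = 1 / (384 * real k * real g)"
  \<comment> \<open>Half of the exponent constant for atypical subsets; the other half pays for the
    union bounds.\<close>
  define c where "c = \<delta>\<^sup>2 / real k ^ (k - 1)"
  \<comment> \<open>A sum instead of a maximum, so that linear arithmetic recovers each
    threshold.\<close>
  define n0 where "n0 = nat \<lceil>5 / c\<rceil> + nat \<lceil>2 * real k ^ k * (2 + c)\<rceil> + 4 * g * k\<^sup>2 + k"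
  have c: "c > 0" using assms by (simp add: c_def \<delta>_def g_def)
  have "real (card (bipartite_graphs k n - good_graphs k n))
      \<le> real (card (bipartite_graphs k n)) / 2 powr (c * real n ^ (k - 1)) \<and>
    (\<forall>H\<in>good_graphs k n. unique_bipartition H \<and>
       constructs_bipartition (n ^ k) (bipartition_prog (k - 2) (4 * g) (2 * g - 1) (8 * k)) n H
         (real (8 * (k - 2) + 30) * real n ^ k))"
    if n: "n \<ge> n0" for n
  proof
    have ns: "5 / c \<le> real n" "2 * real k ^ k * (2 + c) \<le> real n" "4 * g * k\<^sup>2 \<le> n" "k \<le> n" "0 < n"
      using n assms unfolding n0_def by linarith+
    have "real (card (bipartite_graphs k n - good_graphs k n)) \<le> real (card (bipartite_graphs k n)) *
      (2 ^ n * (2 powr (- (real (n choose k) / 2)) + 2 * real n * 2 ^ n * exp (- (2 * c * real n ^ (k - 1)))))"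
      using card_not_good_graphs_le[OF assms, of n] by (simp add: c_def \<delta>_def g_def)
    also have "\<dots> \<le> real (card (bipartite_graphs k n)) * (1 / 2 powr (c * real n ^ (k - 1)))"
      using ns assms c by (intro mult_left_mono union_bound_le) auto
    finally show "real (card (bipartite_graphs k n - good_graphs k n))
      \<le> real (card (bipartite_graphs k n)) / 2 powr (c * real n ^ (k - 1))" by simp
    show "\<forall>H\<in>good_graphs k n. unique_bipartition H \<and>
       constructs_bipartition (n ^ k) (bipartition_prog (k - 2) (4 * g) (2 * g - 1) (8 * k)) n H
         (real (8 * (k - 2) + 30) * real n ^ k)"
      unfolding g_def using ns assms
      by (intro ballI good_graphs_bipartition_constructed) (auto simp: g_def)
  qed
  moreover have "good_graphs k n \<subseteq> bipartite_graphs k n" for n by (auto simp: good_graphs_def)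
  moreover have "real (8 * (k - 2) + 30) > 0" by simp
  ultimately show ?thesis using c by blast
qed

end
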